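(* Let $G$ be an abstract snake graph with $d\ge1$ tiles whose labels are specialized by $b:=i_d$, $w:=i_1$, $z:=a$ (so the west edge of $G_1$ is labeled $i_d$, the $w$-edge of $G_d$ is labeled $i_1$, and the $z$-edge of $G_d$ is labeled $a$). Let $\mathcal S$ be the set of perfect matchings of $G$ that contain the south edge of $G_1$ or the $z$-edge of $G_d$ (its north edge if $d$ is even, its east edge if $d$ is odd). Then $$\sum_{P\in\mathcal S}\frac{x(P)h(P)}{x_a}=x_{i_1}\cdots x_{i_d}\;\mathrm{tr}\!\left(\begin{pmatrix}\frac{x_{i_1}}{x_{i_d}}&x_a\mathsf y_{i_d}\\0&\frac{\mathsf y_{i_d}x_{i_d}}{x_{i_1}}\end{pmatrix}M_d\right).$$ Equivalently, the left-hand side is the generating function $\sum_{\widetilde P} x(\widetilde P)h(\widetilde P)$ over good matchings $\widetilde P$ of the band graph obtained from $G$ by identifying the south edge of $G_1$ with the $z$-edge of $G_d$ (each good matching corresponding to the unique $P\in\mathcal S$ obtained by adding back the missing copy/copies of this identified edge, with $x(\widetilde P)=x(P)/x_a$ and $h(\widetilde P)=h(P)$).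
   Context: Abstract snake graph with $d\ge 1$ tiles: unit squares $G_1,\dots,G_d$ in the plane with $G_1=[0,1]^2$ and, for $1\le j\le d-1$, $G_{j+1}$ equal to the translate of $G_j$ either by $(0,1)$ ("$G_{j+1}$ north of $G_j$") or by $(1,0)$ ("$G_{j+1}$ east of $G_j$"). The graph $G$ has as vertices the corners and as edges the sides of these squares (a shared side is one edge). Edges carry labels from some label set (labels need not be distinct): the south edge of $G_1$ is labeled $a$ and the west edge of $G_1$ is labeled $b$; for $1\le j\le d-1$, the edge shared by $G_j$ and $G_{j+1}$ is labeled $a_j$, and if $G_{j+1}$ is north of $G_j$ then the east edge of $G_j$ is labeled $i_{j+1}$ and the west edge of $G_{j+1}$ is labeled $i_j$, while if $G_{j+1}$ is east of $G_j$ then the north edge of $G_j$ is labeled $i_{j+1}$ and the south edge of $G_{j+1}$ is labeled $i_j$; finally, if $d$ is odd the north edge of $G_d$ is labeled $w$ and its east edge $z$, and if $d$ is even the east edge of $G_d$ is labeled $w$ and its north edge $z$. The tile $G_j$ itself carries the label $i_j$. To each label $\ell$ attach commuting indeterminates $x_\ell$ and (for the tile labels) $\mathsf y_\ell$. For a perfect matching $P$ of $G$, its weight is $x(P)=\prod_{e\in P}x_{\mathrm{label}(e)}$. Let $P_-$ (the minimal matching) be the unique perfect matching of $G$ consisting only of edges on the boundary of $G_1\cup\dots\cup G_d$ and containing the south edge of $G_1$. For every perfect matching $P$, the symmetric difference $P\ominus P_-$ is the set of boundary edges of a union of cycles enclosing a set of tiles $\{G_j: j\in J(P)\}$; the height monomial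 is $h(P)=\prod_{j\in J(P)}\mathsf y_{i_j}$. Matrix of $G$: for $1\le j\le d-1$, let $m_j=\begin{pmatrix}1&0\\ \frac{x_{a_j}}{x_{i_j}x_{i_{j+1}}}&\mathsf y_{i_j}\end{pmatrix}$ if either ($j$ is odd and $G_{j+1}$ is north of $G_j$) or ($j$ is even and $G_{j+1}$ is east of $G_j$), and $m_j=\begin{pmatrix}\frac{x_{i_{j+1}}}{x_{i_j}}&x_{a_j}\mathsf y_{i_j}\\0&\frac{x_{i_j}\mathsf y_{i_j}}{x_{i_{j+1}}}\end{pmatrix}$ otherwise. Set $M_d=m_{d-1}\cdots m_1$ for $d\ge2$ and $M_1$ the $2\times 2$ identity matrix. Band graph and good matchings: identify the south edge of $G_1$, from $x=(0,0)$ to $y=(1,0)$, with the $z$-edge of $G_d$, gluing $x$ to the endpoint $x'$ of the $z$-edge which is the north-east corner of $G_d$ and $y$ to its other endpoint $y'$. A perfect matching of this band graph is good if either $x$ and $y$ are matched to each other, or the two matching edges at $x$ and at $y$ lie on the same side of the identified (cut) edge. $\mathrm{tr}$ denotes the trace. *)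

theory Defs
  imports "HOL-Analysis.Analysis"
begin

text \<open>Lattice points and edges (an edge is the two-element set of its endpoints).\<close>
type_synonym pt = "int \<times> int"
type_synonym edge = "pt set"

text \<open>Tile positions: tile j (1 \<le> j \<le> d) has south-west corner tpos nr j;
  nr j = True means G_(j+1) is north of G_j, False means east.\<close>
fun tpos :: "(nat \<Rightarrow> bool) \<Rightarrow> nat \<Rightarrow> pt" where
  "tpos nr 0 = (0, 0)"
| "tpos nr (Suc 0) = (0, 0)"
| "tpos nr (Suc (Suc j)) =
     (if nr (Suc j) then (fst (tpos nr (Suc j)), snd (tpos nr (Suc j)) + 1)
      else (fst (tpos nr (Suc j)) + 1, snd (tpos nr (Suc j))))"

definition south_e :: "pt \<Rightarrow> edge" where
  "south_e p = {(fst p, snd p), (fst p + 1, snd p)}"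
definition north_e :: "pt \<Rightarrow> edge" where
  "north_e p = {(fst p, snd p + 1), (fst p + 1, snd p + 1)}"
definition west_e :: "pt \<Rightarrow> edge" where
  "west_e p = {(fst p, snd p), (fst p, snd p + 1)}"
definition east_e :: "pt \<Rightarrow> edge" where
  "east_e p = {(fst p + 1, snd p), (fst p + 1, snd p + 1)}"

definition tile_edges :: "pt \<Rightarrow> edge set" where
  "tile_edges p = {south_e p, north_e p, west_e p, east_e p}"

definition snake_edges :: "(nat \<Rightarrow> bool) \<Rightarrow> nat \<Rightarrow> edge set" where
  "snake_edges nr d = (\<Union>j\<in>{1..d}. tile_edges (tpos nr j))"

definition snake_verts :: "(nat \<Rightarrow> bool) \<Rightarrow> nat \<Rightarrow> pt set" where
  "snake_verts nr d = \<Union>(snake_edges nr d)"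

definition boundary_edges :: "(nat \<Rightarrow> bool) \<Rightarrow> nat \<Rightarrow> edge set" where
  "boundary_edges nr d =
     {e \<in> snake_edges nr d. card {j \<in> {1..d}. e \<in> tile_edges (tpos nr j)} = 1}"

definition perfect_matching :: "(nat \<Rightarrow> bool) \<Rightarrow> nat \<Rightarrow> edge set \<Rightarrow> bool" where
  "perfect_matching nr d P \<longleftrightarrow>
     P \<subseteq> snake_edges nr d \<and> (\<forall>v \<in> snake_verts nr d. \<exists>!e. e \<in> P \<and> v \<in> e)"

definition min_matching :: "(nat \<Rightarrow> bool) \<Rightarrow> nat \<Rightarrow> edge set" where
  "min_matching nr d = (THE P. perfect_matching nr d P \<and> P \<subseteq> boundary_edges nr d
                              \<and> south_e (tpos nr 1) \<in> P)"

text \<open>The labelling of the edges, with the specialisation b = i_d, w = i_1, z = a.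
  Parameters: a (south edge of G_1), aa j (= a_j), i j (= i_j).\<close>
definition snake_labels ::
  "(nat \<Rightarrow> bool) \<Rightarrow> nat \<Rightarrow> 'l \<Rightarrow> (nat \<Rightarrow> 'l) \<Rightarrow> (nat \<Rightarrow> 'l) \<Rightarrow> (edge \<times> 'l) set" where
  "snake_labels nr d a aa i =
     {(south_e (tpos nr 1), a), (west_e (tpos nr 1), i d)}
     \<union> (\<Union>j\<in>{1..<d}. if nr j
          then {(north_e (tpos nr j), aa j), (east_e (tpos nr j), i (j + 1)),
                (west_e (tpos nr (j + 1)), i j)}
          else {(east_e (tpos nr j), aa j), (north_e (tpos nr j), i (j + 1)),
                (south_e (tpos nr (j + 1)), i j)})
     \<union> (if odd d then {(north_e (tpos nr d), i 1), (east_e (tpos nr d), a)}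
        else {(east_e (tpos nr d), i 1), (north_e (tpos nr d), a)})"

definition edge_label :: "(edge \<times> 'l) set \<Rightarrow> edge \<Rightarrow> 'l" where
  "edge_label L e = (THE l. (e, l) \<in> L)"

definition z_edge :: "(nat \<Rightarrow> bool) \<Rightarrow> nat \<Rightarrow> edge" where
  "z_edge nr d = (if odd d then east_e (tpos nr d) else north_e (tpos nr d))"

definition match_weight ::
  "(nat \<Rightarrow> bool) \<Rightarrow> nat \<Rightarrow> 'l \<Rightarrow> (nat \<Rightarrow> 'l) \<Rightarrow> (nat \<Rightarrow> 'l) \<Rightarrow> ('l \<Rightarrow> 'a::comm_monoid_mult)
    \<Rightarrow> edge set \<Rightarrow> 'a" where
  "match_weight nr d a aa i x P = (\<Prod>e\<in>P. x (edge_label (snake_labels nr d a aa i) e))"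

text \<open>A tile with south-west corner p is enclosed by the cycle union D (a set of edges)
  iff the horizontal ray from its centre going west crosses an odd number of
  edges of D (even-odd rule for the region bounded by D).\<close>
definition tile_enclosed :: "edge set \<Rightarrow> pt \<Rightarrow> bool" where
  "tile_enclosed D p \<longleftrightarrow> odd (card {e \<in> D. \<exists>c \<le> fst p. e = west_e (c, snd p)})"

definition height ::
  "(nat \<Rightarrow> bool) \<Rightarrow> nat \<Rightarrow> (nat \<Rightarrow> 'l) \<Rightarrow> ('l \<Rightarrow> 'a::comm_monoid_mult) \<Rightarrow> edge set \<Rightarrow> 'a" where
  "height nr d i y P =
     (let D = (P - min_matching nr d) \<union> (min_matching nr d - P)
      in \<Prod>j\<in>{j \<in> {1..d}. tile_enclosed D (tpos nr j)}. y (i j))"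

definition mat2 :: "'a::zero \<Rightarrow> 'a \<Rightarrow> 'a \<Rightarrow> 'a \<Rightarrow> 'a^2^2" where
  "mat2 p q r s = (\<chi> k l. if k = 1 then (if l = 1 then p else q) else (if l = 1 then r else s))"

definition snake_mj ::
  "(nat \<Rightarrow> bool) \<Rightarrow> (nat \<Rightarrow> 'l) \<Rightarrow> (nat \<Rightarrow> 'l) \<Rightarrow> ('l \<Rightarrow> 'a::field) \<Rightarrow> ('l \<Rightarrow> 'a) \<Rightarrow> nat \<Rightarrow> 'a^2^2" where
  "snake_mj nr aa i x y j =
     (if (odd j \<and> nr j) \<or> (even j \<and> \<not> nr j)
      then mat2 1 0 (x (aa j) / (x (i j) * x (i (j + 1)))) (y (i j))
      else mat2 (x (i (j + 1)) / x (i j)) (x (aa j) * y (i j))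
                0 (x (i j) * y (i j) / x (i (j + 1))))"

fun snake_Mprod ::
  "(nat \<Rightarrow> bool) \<Rightarrow> (nat \<Rightarrow> 'l) \<Rightarrow> (nat \<Rightarrow> 'l) \<Rightarrow> ('l \<Rightarrow> 'a::field) \<Rightarrow> ('l \<Rightarrow> 'a) \<Rightarrow> nat \<Rightarrow> 'a^2^2" where
  "snake_Mprod nr aa i x y 0 = mat 1"
| "snake_Mprod nr aa i x y (Suc k) = snake_mj nr aa i x y (Suc k) ** snake_Mprod nr aa i x y k"

definition snake_M ::
  "(nat \<Rightarrow> bool) \<Rightarrow> nat \<Rightarrow> (nat \<Rightarrow> 'l) \<Rightarrow> (nat \<Rightarrow> 'l) \<Rightarrow> ('l \<Rightarrow> 'a::field) \<Rightarrow> ('l \<Rightarrow> 'a) \<Rightarrow> 'a^2^2" where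
  "snake_M nr d aa i x y = snake_Mprod nr aa i x y (d - 1)"

end

theory Submission
  imports Defs
begin

text \<open>
  Gluing a new tile onto an edge \<open>e\<close> of the last one, a perfect matching of the longer snake either
  uses the edge opposite to \<open>e\<close> and restricts to a perfect matching of the shorter snake, or uses the
  two sides of the new tile and arises from a perfect matching through \<open>e\<close> by replacing \<open>e\<close>. The
  minimal matching grows by the same rule, always through the \<open>w\<close>-edge of the last tile, so the
  symmetric difference with it either stays the same or changes by the four edges of the new tile; the
  latter happens exactly if the matching contains the \<open>z\<close>-edge of the new tile, which is then the only
  tile whose even-odd status flips. Hence the generating functions of the matchings through the
  \<open>w\<close>-edge and through the \<open>z\<close>-edge of the last tile form a vector that, suitably normalised, is
  multiplied by \<open>m\<^sub>j\<close> when the tile \<open>j + 1\<close> is added. Starting with the south or the west edge of the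
  first tile gives the two columns of \<open>M\<^sub>d\<close>, and the matchings in question contribute the trace.
\<close>

section \<open>Gluing a square to a graph\<close>

text \<open>Vertices are the endpoints of the given edges and may have any type, so that gluing is
  studied without coordinates.\<close>

definition matchings :: "'v set set \<Rightarrow> 'v set set set" where
  "matchings E = {P. P \<subseteq> E \<and> (\<forall>v\<in>\<Union>E. \<exists>!e. e \<in> P \<and> v \<in> e)}"

lemma matchingsI:
  "P \<subseteq> E \<Longrightarrow> (\<And>v. v \<in> \<Union>E \<Longrightarrow> \<exists>!e. e \<in> P \<and> v \<in> e) \<Longrightarrow> P \<in> matchings E"
  unfolding matchings_def by blast

lemma matchingsD:
  "P \<in> matchings E \<Longrightarrow> P \<subseteq> E"
  "P \<in> matchings E \<Longrightarrow> v \<in> \<Union>E \<Longrightarrow> \<exists>!e. e \<in> P \<and> v \<in> e"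
  unfolding matchings_def by blast+

lemma matchings_unique:
  assumes "P \<in> matchings E" "e \<in> P" "f \<in> P" "v \<in> e" "v \<in> f"
  shows "e = f"
proof -
  have "v \<in> \<Union>E" using matchingsD(1)[OF assms(1)] assms by auto
  from matchingsD(2)[OF assms(1) this] assms show ?thesis by auto
qed

text \<open>The new vertices \<open>p'\<close> and \<open>q'\<close> lie on the three new edges
  only. Either \<open>{p', q'}\<close> covers both of them, or they are forced onto
  \<open>{p, p'}\<close> and \<open>{q, q'}\<close>; these then also cover \<open>p\<close> and
  \<open>q\<close>, and \<open>{p, q}\<close> can take their place in the old graph.\<close>

lemma matchings_glue_square:
  assumes sh: "{p, q} \<in> E" and new: "p' \<notin> \<Union>E" "q' \<notin> \<Union>E" "p' \<noteq> q'" and pq: "p \<noteq> q"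
  shows "matchings (E \<union> {{p', q'}, {p, p'}, {q, q'}}) =
     insert {p', q'} ` matchings E \<union>
     (\<lambda>P. P - {{p, q}} \<union> {{p, p'}, {q, q'}}) ` {P \<in> matchings E. {p, q} \<in> P}"
    (is "matchings ?E' = ?A \<union> ?B")
proof (rule set_eqI, rule iffI)
  have pV: "p \<in> \<Union>E" "q \<in> \<Union>E" using sh by auto
  have UE': "\<Union>?E' = \<Union>E \<union> {p', q'}" using pV by auto
  have neq: "p \<noteq> p'" "p \<noteq> q'" "q \<noteq> p'" "q \<noteq> q'" using pV new by auto
  fix P' assume "P' \<in> ?A \<union> ?B"
  then show "P' \<in> matchings ?E'"
  proof
    assume "P' \<in> ?A"
    then obtain P where P: "P \<in> matchings E" "P' = insert {p', q'} P" by auto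
    note PE = matchingsD(1)[OF P(1)] and un = matchingsD(2)[OF P(1)]
    have "\<exists>!e. e \<in> P' \<and> v \<in> e" if "v \<in> \<Union>?E'" for v
    proof (cases "v \<in> \<Union>E")
      case True
      then have "v \<noteq> p'" "v \<noteq> q'" using new by auto
      then have "\<And>e. e \<in> P' \<and> v \<in> e \<longleftrightarrow> e \<in> P \<and> v \<in> e" using P(2) by auto
      then show ?thesis using un[OF True] by simp
    next
      case False
      then have v: "v \<in> {p', q'}" using that UE' by auto
      have "\<And>e. e \<in> P' \<and> v \<in> e \<longleftrightarrow> e = {p', q'}" using P(2) PE v False by auto
      then show ?thesis by simp
    qed
    moreover have "P' \<subseteq> ?E'" using PE P(2) by auto
    ultimately show ?thesis by (intro matchingsI)
  next
    assume "P' \<in> ?B"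
    then obtain P where P: "P \<in> matchings E" "{p, q} \<in> P"
      "P' = P - {{p, q}} \<union> {{p, p'}, {q, q'}}" by auto
    note PE = matchingsD(1)[OF P(1)] and un = matchingsD(2)[OF P(1)]
    \<comment> \<open>Removing \<open>{p, q}\<close> therefore uncovers exactly \<open>p\<close> and
      \<open>q\<close>, which the two sides cover again.\<close>
    have only: "e = {p, q}" if "e \<in> P" "p \<in> e \<or> q \<in> e" for e
      using matchings_unique[OF P(1) that(1) P(2)] that(2) by auto
    have "\<exists>!e. e \<in> P' \<and> v \<in> e" if v: "v \<in> \<Union>?E'" for v
    proof -
      consider "v = p \<or> v = p'" | "v = q \<or> v = q'" | "v \<in> \<Union>E" "v \<notin> {p, q, p', q'}"
        using v[unfolded UE'] by auto
      then show ?thesis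
      proof cases
        case 1
        have "\<And>e. e \<in> P' \<and> v \<in> e \<longleftrightarrow> e = {p, p'}"
          using 1 only PE new neq pq unfolding P(3) by auto
        then show ?thesis by simp
      next
        case 2
        have "\<And>e. e \<in> P' \<and> v \<in> e \<longleftrightarrow> e = {q, q'}"
          using 2 only PE new neq pq unfolding P(3) by auto
        then show ?thesis by simp
      next
        case 3
        have "\<And>e. e \<in> P' \<and> v \<in> e \<longleftrightarrow> e \<in> P \<and> v \<in> e" using P(3) 3 by auto
        then show ?thesis using un[OF 3(1)] by simp
      qed
    qed
    moreover have "P' \<subseteq> ?E'" using PE P(3) by auto
    ultimately show ?thesis by (intro matchingsI)
  qed
next
  have pV: "p \<in> \<Union>E" "q \<in> \<Union>E" using sh by auto
  have UE': "\<Union>?E' = \<Union>E \<union> {p', q'}" using pV by auto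
  have neq: "p \<noteq> p'" "p \<noteq> q'" "q \<noteq> p'" "q \<noteq> q'" using pV new by auto
  fix P' assume P': "P' \<in> matchings ?E'"
  note P'E = matchingsD(1)[OF P'] and un = matchingsD(2)[OF P', unfolded UE']
  have at_new: "e = {p', q'} \<or> e = {p, p'} \<or> e = {q, q'}" if "e \<in> P'" "p' \<in> e \<or> q' \<in> e" for e
  proof -
    have "e \<notin> E" using that(2) new(1,2) by auto
    then show ?thesis using that(1) P'E by auto
  qed
  show "P' \<in> ?A \<union> ?B"
  proof (cases "{p', q'} \<in> P'")
    case True
    have no: "{p, p'} \<notin> P'" "{q, q'} \<notin> P'"
      using matchings_unique[OF P' True, of "{p, p'}" p'] matchings_unique[OF P' True, of "{q, q'}" q']
        neq by (auto simp: doubleton_eq_iff)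
    define P where "P = P' - {{p', q'}}"
    have PE: "P \<subseteq> E" using P'E no by (auto simp: P_def)
    have "\<exists>!e. e \<in> P \<and> v \<in> e" if "v \<in> \<Union>E" for v
    proof -
      have "v \<noteq> p'" "v \<noteq> q'" using that new by auto
      then have "\<And>e. e \<in> P \<and> v \<in> e \<longleftrightarrow> e \<in> P' \<and> v \<in> e" by (auto simp: P_def)
      then show ?thesis using un[of v] that by simp
    qed
    then have "P \<in> matchings E" using PE by (intro matchingsI)
    moreover have "P' = insert {p', q'} P" using True by (auto simp: P_def)
    ultimately show ?thesis by blast
  next
    case False
    have sd: "{p, p'} \<in> P'"
    proof -
      obtain e where "e \<in> P'" "p' \<in> e" using un[of p'] by auto
      then show ?thesis using at_new[of e] False neq new(3) by auto
    qed
    have tt: "{q, q'} \<in> P'"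
    proof -
      obtain e where "e \<in> P'" "q' \<in> e" using un[of q'] by auto
      then show ?thesis using at_new[of e] False neq new(3) by auto
    qed
    have at_p: "e = {p, p'}" if "e \<in> P'" "p \<in> e" for e
      using matchings_unique[OF P' that(1) sd that(2)] by simp
    have at_q: "e = {q, q'}" if "e \<in> P'" "q \<in> e" for e
      using matchings_unique[OF P' that(1) tt that(2)] by simp
    have nsh: "{p, q} \<notin> P'" using at_p[of "{p, q}"] neq pq by (auto simp: doubleton_eq_iff)
    \<comment> \<open>This undoes the exchange: among the old vertices, deleting the two sides
      uncovers just \<open>p\<close> and \<open>q\<close>.\<close>
    define P where "P = insert {p, q} (P' - {{p, p'}, {q, q'}})"
    have PE: "P \<subseteq> E" using P'E False sh by (auto simp: P_def)
    have "\<exists>!e. e \<in> P \<and> v \<in> e" if v: "v \<in> \<Union>E" for v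
    proof (cases "v = p \<or> v = q")
      case True
      then have "\<And>e. e \<in> P \<and> v \<in> e \<longleftrightarrow> e = {p, q}" using at_p at_q by (auto simp: P_def)
      then show ?thesis by simp
    next
      case False
      have "v \<noteq> p'" "v \<noteq> q'" using v new by auto
      then have "\<And>e. e \<in> P \<and> v \<in> e \<longleftrightarrow> e \<in> P' \<and> v \<in> e" using False by (auto simp: P_def)
      then show ?thesis using un[of v] v by simp
    qed
    then have "P \<in> matchings E" using PE by (intro matchingsI)
    then have "P \<in> {P \<in> matchings E. {p, q} \<in> P}" by (simp add: P_def)
    moreover have "P' = P - {{p, q}} \<union> {{p, p'}, {q, q'}}"
    proof -
      have "P - {{p, q}} = P' - {{p, p'}, {q, q'}}" using nsh by (simp add: P_def)
      then show ?thesis using sd tt by blast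
    qed
    ultimately show ?thesis by (intro UnI2 image_eqI)
  qed
qed

section \<open>Geometry of the snake\<close>

lemma perfect_matching_iff: "perfect_matching nr d P \<longleftrightarrow> P \<in> matchings (snake_edges nr d)"
  by (simp add: perfect_matching_def matchings_def snake_verts_def)

lemmas edge_defs = south_e_def north_e_def west_e_def east_e_def

text \<open>An edge has two names, one from the unit square on each side of it. Apart from this the
  position determines the edge, and horizontal and vertical edges never coincide.\<close>

lemma edge_eq_iff [simp]:
  "south_e p = south_e q \<longleftrightarrow> p = q"
  "west_e p = west_e q \<longleftrightarrow> p = q"
  "north_e p = north_e q \<longleftrightarrow> p = q"
  "east_e p = east_e q \<longleftrightarrow> p = q"
  "south_e p \<noteq> west_e q" "west_e q \<noteq> south_e p"
  "south_e p \<noteq> east_e q" "east_e q \<noteq> south_e p"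
  "north_e p \<noteq> west_e q" "west_e q \<noteq> north_e p"
  "north_e p \<noteq> east_e q" "east_e q \<noteq> north_e p"
  "south_e p = north_e q \<longleftrightarrow> p = (fst q, snd q + 1)"
  "north_e q = south_e p \<longleftrightarrow> p = (fst q, snd q + 1)"
  "west_e p = east_e q \<longleftrightarrow> p = (fst q + 1, snd q)"
  "east_e q = west_e p \<longleftrightarrow> p = (fst q + 1, snd q)"
  by (cases p; cases q; auto simp: edge_defs doubleton_eq_iff)+

section \<open>Crossing parity and the even-odd rule\<close>

lemma odd_card_sym_diff:
  assumes "finite A" "finite B"
  shows "odd (card (sym_diff A B)) \<longleftrightarrow> odd (card A) \<noteq> odd (card B)"
proof -
  have "card A = card (A - B) + card (A \<inter> B)"
    using assms by (metis card_Int_Diff add.commute)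
  moreover have "card B = card (B - A) + card (A \<inter> B)"
    using assms by (metis card_Int_Diff add.commute Int_commute)
  moreover have "card (sym_diff A B) = card (A - B) + card (B - A)"
    using assms by (intro card_Un_disjoint) auto
  ultimately show ?thesis by presburger
qed

text \<open>The westward ray from the tile at \<open>p\<close> can meet the tile at \<open>q\<close>
  only if both are in the same row. It meets both vertical edges if \<open>q\<close> is strictly to
  the west, one if \<open>q = p\<close>, and none if \<open>q\<close> is to the east; only the
  middle case changes the parity.\<close>

lemma tile_enclosed_sym_diff_tile:
  assumes "finite D"
  shows "tile_enclosed (sym_diff D (tile_edges q)) p \<longleftrightarrow> tile_enclosed D p \<noteq> (p = q)"
proof -
  define R where "R = (\<lambda>e. \<exists>c \<le> fst p. e = west_e (c, snd p))"
  have R: "R (south_e q) = False" "R (north_e q) = False"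
    "R (west_e q) = (snd q = snd p \<and> fst q \<le> fst p)"
    "R (east_e q) = (snd q = snd p \<and> fst q + 1 \<le> fst p)"
    by (cases q; auto simp: R_def)+
  have sets: "{e \<in> sym_diff D (tile_edges q). R e} = sym_diff {e \<in> D. R e} {e \<in> tile_edges q. R e}"
    by auto
  have fin: "finite (tile_edges q)" by (simp add: tile_edges_def)
  have tile: "{e \<in> tile_edges q. R e} = (if R (west_e q) then {west_e q} else {}) \<union>
      (if R (east_e q) then {east_e q} else {})"
    unfolding tile_edges_def using R(1,2) by auto
  have ne: "west_e q \<noteq> east_e q" by (cases q) auto
  have "odd (card {e \<in> tile_edges q. R e}) \<longleftrightarrow> p = q"
    unfolding tile R(3,4) using ne by (cases p; cases q) auto
  moreover have "tile_enclosed X p \<longleftrightarrow> odd (card {e \<in> X. R e})" for X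
    by (simp add: tile_enclosed_def R_def)
  moreover have "finite {e \<in> D. R e}" "finite {e \<in> tile_edges q. R e}" using assms fin by auto
  ultimately show ?thesis
    by (simp only: sets odd_card_sym_diff)
qed

section \<open>Levels of tiles and vertices\<close>

lemma tpos_Suc:
  assumes "d \<ge> 1"
  shows "tpos nr (Suc d) = (if nr d then (fst (tpos nr d), snd (tpos nr d) + 1)
                            else (fst (tpos nr d) + 1, snd (tpos nr d)))"
  using assms by (cases d) auto

text \<open>Each step raises the coordinate sum, the level, by one. The level identifies a tile and
  tells new vertices from old ones.\<close>

lemma tpos_level: "d \<ge> 1 \<Longrightarrow> fst (tpos nr d) + snd (tpos nr d) = int d - 1"
  by (induction d rule: dec_induct) (auto simp: tpos_Suc)

lemma tpos_inj:
  assumes "j \<ge> 1" "k \<ge> 1"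
  shows "tpos nr j = tpos nr k \<longleftrightarrow> j = k"
proof
  assume "tpos nr j = tpos nr k"
  then have "int j - 1 = int k - 1" using tpos_level assms by metis
  then show "j = k" by simp
qed simp

lemma snake_edges_Suc: "snake_edges nr (Suc d) = snake_edges nr d \<union> tile_edges (tpos nr (Suc d))"
  by (auto simp: snake_edges_def atLeastAtMostSuc_conv)

lemma snake_edges_1: "snake_edges nr 1 = tile_edges (0, 0)"
  by (simp add: snake_edges_def)

lemma finite_snake_edges: "finite (snake_edges nr d)"
  by (auto simp: snake_edges_def tile_edges_def)

lemma finite_matchings: "finite (matchings (snake_edges nr d))"
  by (rule finite_subset[of _ "Pow (snake_edges nr d)"])
    (auto simp: matchings_def finite_snake_edges)

text \<open>Tile \<open>j\<close> has vertices on the levels \<open>j - 1\<close>, \<open>j\<close>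
  and \<open>j + 1\<close> only, and just its north-east corner is on the highest of them.\<close>

lemma snake_vertex_level:
  assumes "v \<in> \<Union>(snake_edges nr d)"
  shows "fst v + snd v \<le> int d + 1"
    "fst v + snd v = int d + 1 \<Longrightarrow> v = (fst (tpos nr d) + 1, snd (tpos nr d) + 1)"
proof -
  obtain j where j: "1 \<le> j" "j \<le> d" and v: "v \<in> \<Union>(tile_edges (tpos nr j))"
    using assms unfolding snake_edges_def by fastforce
  have *: "fst v + snd v \<le> int j + 1"
    "fst v + snd v = int j + 1 \<Longrightarrow> v = (fst (tpos nr j) + 1, snd (tpos nr j) + 1)"
    using v tpos_level[OF j(1), of nr] by (auto simp: tile_edges_def edge_defs)
  show "fst v + snd v \<le> int d + 1" using * j by linarith
  show "v = (fst (tpos nr d) + 1, snd (tpos nr d) + 1)" if "fst v + snd v = int d + 1"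
  proof -
    have "j = d" using that * j by linarith
    then show ?thesis using * that by simp
  qed
qed

text \<open>Seen from the edge shared by the tiles \<open>d\<close> and \<open>d + 1\<close>, the tile \<open>d + 1\<close> contributes three
  new edges: the one opposite to the shared edge, the side through the north-east corner, and the
  remaining side.\<close>

definition shared_edge :: "(nat \<Rightarrow> bool) \<Rightarrow> nat \<Rightarrow> edge" where
  "shared_edge nr d = (if nr d then north_e (tpos nr d) else east_e (tpos nr d))"
definition opposite_edge :: "(nat \<Rightarrow> bool) \<Rightarrow> nat \<Rightarrow> edge" where
  "opposite_edge nr d = (if nr d then north_e (tpos nr (Suc d)) else east_e (tpos nr (Suc d)))"
definition outer_side :: "(nat \<Rightarrow> bool) \<Rightarrow> nat \<Rightarrow> edge" where
  "outer_side nr d = (if nr d then east_e (tpos nr (Suc d)) else north_e (tpos nr (Suc d)))"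
definition inner_side :: "(nat \<Rightarrow> bool) \<Rightarrow> nat \<Rightarrow> edge" where
  "inner_side nr d = (if nr d then west_e (tpos nr (Suc d)) else south_e (tpos nr (Suc d)))"

lemmas new_edge_defs = shared_edge_def opposite_edge_def outer_side_def inner_side_def

lemma tile_edges_new:
  "d \<ge> 1 \<Longrightarrow> tile_edges (tpos nr (Suc d)) =
     {shared_edge nr d, opposite_edge nr d, outer_side nr d, inner_side nr d}"
  by (auto simp: new_edge_defs tile_edges_def tpos_Suc edge_defs)

lemma shared_edge_in: "d \<ge> 1 \<Longrightarrow> shared_edge nr d \<in> snake_edges nr d"
  by (cases d) (auto simp: snake_edges_Suc shared_edge_def tile_edges_def)

lemma snake_edges_new:
  "d \<ge> 1 \<Longrightarrow> snake_edges nr (Suc d) =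
     snake_edges nr d \<union> {opposite_edge nr d, outer_side nr d, inner_side nr d}"
  using shared_edge_in[of d nr] by (auto simp: snake_edges_Suc tile_edges_new)

text \<open>These are the hypotheses of \<open>matchings_glue_square\<close>, with \<open>p\<close>
  and \<open>p'\<close> the north-east corners of the tiles \<open>d\<close> and
  \<open>d + 1\<close>. The new vertices are on the levels \<open>d + 1\<close> and
  \<open>d + 2\<close>, where the old snake has no vertex but \<open>p\<close>.\<close>

lemma new_square:
  assumes "d \<ge> 1"
  obtains p q p' q' where "shared_edge nr d = {p, q}" "opposite_edge nr d = {p', q'}"
    "outer_side nr d = {p, p'}" "inner_side nr d = {q, q'}"
    "p' \<notin> \<Union>(snake_edges nr d)" "q' \<notin> \<Union>(snake_edges nr d)" "p' \<noteq> q'" "p \<noteq> q"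
proof -
  obtain X Y where XY: "tpos nr d = (X, Y)" by fastforce
  have lev: "X + Y = int d - 1" using tpos_level[OF assms, of nr] XY by simp
  have out: "v \<notin> \<Union>(snake_edges nr d)"
    if "fst v + snd v > int d \<and> v \<noteq> (X + 1, Y + 1)" for v
    using snake_vertex_level[of v nr d] that XY by fastforce
  show ?thesis
  proof (cases "nr d")
    case True
    show ?thesis
    proof (rule that[of "(X+1,Y+1)" "(X,Y+1)" "(X+1,Y+2)" "(X,Y+2)"])
      show "(X+1,Y+2) \<notin> \<Union>(snake_edges nr d)" "(X,Y+2) \<notin> \<Union>(snake_edges nr d)"
        by (rule out, use lev in simp)+
    qed (use True assms XY in \<open>auto simp: new_edge_defs edge_defs tpos_Suc\<close>)
  next
    case False
    show ?thesis
    proof (rule that[of "(X+1,Y+1)" "(X+1,Y)" "(X+2,Y+1)" "(X+2,Y)"])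
      show "(X+2,Y+1) \<notin> \<Union>(snake_edges nr d)" "(X+2,Y) \<notin> \<Union>(snake_edges nr d)"
        by (rule out, use lev in simp)+
    qed (use False assms XY in \<open>auto simp: new_edge_defs edge_defs tpos_Suc\<close>)
  qed
qed

text \<open>Each new edge contains \<open>p'\<close> or \<open>q'\<close>, which the old snake does
  not have.\<close>

lemma new_edges_fresh:
  assumes "d \<ge> 1"
  shows "opposite_edge nr d \<notin> snake_edges nr d" "outer_side nr d \<notin> snake_edges nr d"
    "inner_side nr d \<notin> snake_edges nr d"
    "opposite_edge nr d \<noteq> outer_side nr d" "opposite_edge nr d \<noteq> inner_side nr d"
    "outer_side nr d \<noteq> inner_side nr d"
proof -
  obtain p q p' q' where *: "shared_edge nr d = {p, q}" "opposite_edge nr d = {p', q'}"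
    "outer_side nr d = {p, p'}" "inner_side nr d = {q, q'}"
    "p' \<notin> \<Union>(snake_edges nr d)" "q' \<notin> \<Union>(snake_edges nr d)" "p' \<noteq> q'" "p \<noteq> q"
    using new_square[OF assms] by metis
  have "p \<in> \<Union>(snake_edges nr d)" "q \<in> \<Union>(snake_edges nr d)"
    using shared_edge_in[OF assms, of nr] *(1) by auto
  then show "opposite_edge nr d \<notin> snake_edges nr d" "outer_side nr d \<notin> snake_edges nr d"
    "inner_side nr d \<notin> snake_edges nr d"
    "opposite_edge nr d \<noteq> outer_side nr d" "opposite_edge nr d \<noteq> inner_side nr d"
    "outer_side nr d \<noteq> inner_side nr d"
    using *(2-) by (auto simp: doubleton_eq_iff)
qed

section \<open>Matchings of the snake with one more tile\<close>

definition swap_sides :: "(nat \<Rightarrow> bool) \<Rightarrow> nat \<Rightarrow> edge set \<Rightarrow> edge set" where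
  "swap_sides nr d P = P - {shared_edge nr d} \<union> {outer_side nr d, inner_side nr d}"

lemma matchings_Suc:
  assumes "d \<ge> 1"
  shows "matchings (snake_edges nr (Suc d)) =
     insert (opposite_edge nr d) ` matchings (snake_edges nr d) \<union>
     swap_sides nr d ` {P \<in> matchings (snake_edges nr d). shared_edge nr d \<in> P}"
proof -
  obtain p q p' q' where *: "shared_edge nr d = {p, q}" "opposite_edge nr d = {p', q'}"
    "outer_side nr d = {p, p'}" "inner_side nr d = {q, q'}"
    "p' \<notin> \<Union>(snake_edges nr d)" "q' \<notin> \<Union>(snake_edges nr d)" "p' \<noteq> q'" "p \<noteq> q"
    using new_square[OF assms] by metis
  show ?thesis
    unfolding snake_edges_new[OF assms] swap_sides_def *(1-4)
    by (rule matchings_glue_square) (use * shared_edge_in[OF assms, of nr] in auto)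
qed

text \<open>The first tile is itself a square glued to a graph, namely to the single edge
  \<open>south_e (0, 0)\<close>.\<close>

lemma matchings_1:
  "matchings (snake_edges nr 1) =
     {{south_e (0, 0), north_e (0, 0)}, {west_e (0, 0), east_e (0, 0)}}"
proof -
  \<comment> \<open>The endpoints are ordered so that the sides literally fit
    \<open>matchings_glue_square\<close> with \<open>p = (1, 0)\<close>, \<open>q = (0, 0)\<close>,
    \<open>p' = (1, 1)\<close> and \<open>q' = (0, 1)\<close>.\<close>
  have S: "south_e (0, 0) = {(1, 0), (0, 0)}" and N: "north_e (0, 0) = {(1, 1), (0, 1)}"
    and E: "east_e (0, 0) = {(1, 0), (1, 1)}" and W: "west_e (0, 0) = {(0, 0), (0, 1)}"
    by (auto simp: edge_defs)
  have edges: "snake_edges nr 1 = {south_e (0, 0)} \<union> {north_e (0, 0), east_e (0, 0), west_e (0, 0)}"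
    unfolding snake_edges_1 by (auto simp: tile_edges_def)
  have single: "matchings {south_e (0, 0)} = {{south_e (0, 0)}}"
    by (auto simp: matchings_def S)
  have "matchings (snake_edges nr 1) = insert (north_e (0, 0)) ` matchings {south_e (0, 0)} \<union>
    (\<lambda>P. P - {south_e (0, 0)} \<union> {east_e (0, 0), west_e (0, 0)}) `
      {P \<in> matchings {south_e (0, 0)}. south_e (0, 0) \<in> P}"
    unfolding edges unfolding S N E W by (rule matchings_glue_square) auto
  also have "\<dots> = {{south_e (0, 0), north_e (0, 0)}, {west_e (0, 0), east_e (0, 0)}}"
    unfolding single by auto
  finally show ?thesis .
qed

text \<open>Taken for every length, so that each initial piece of the snake has its own
  \<open>w\<close>-edge and \<open>z\<close>-edge, the two edges at the north-east corner of its
  last tile.\<close>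

definition w_edge :: "(nat \<Rightarrow> bool) \<Rightarrow> nat \<Rightarrow> edge" where
  "w_edge nr d = (if odd d then north_e (tpos nr d) else east_e (tpos nr d))"

text \<open>\<open>shares_w nr d\<close> is the condition that selects the first form of \<open>m\<^sub>d\<close>; it says that the tiles
  \<open>d\<close> and \<open>d + 1\<close> share the \<open>w\<close>-edge of tile \<open>d\<close>, otherwise they share its \<open>z\<close>-edge.\<close>

definition shares_w :: "(nat \<Rightarrow> bool) \<Rightarrow> nat \<Rightarrow> bool" where
  "shares_w nr d \<longleftrightarrow> (odd d \<and> nr d) \<or> (even d \<and> \<not> nr d)"

text \<open>The parity of the index changes from one tile to the next, so \<open>w\<close> and
  \<open>z\<close> trade directions: crossing the new tile from the shared edge to the opposite one
  leads from \<open>w\<close> to \<open>z\<close>, and from \<open>z\<close> to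
  \<open>w\<close>.\<close>

lemma shares_w_edges:
  assumes "shares_w nr d"
  shows "shared_edge nr d = w_edge nr d" "opposite_edge nr d = z_edge nr (Suc d)"
    "outer_side nr d = w_edge nr (Suc d)"
  using assms by (auto simp: shares_w_def new_edge_defs w_edge_def z_edge_def)

lemma not_shares_w_edges:
  assumes "\<not> shares_w nr d"
  shows "shared_edge nr d = z_edge nr d" "opposite_edge nr d = w_edge nr (Suc d)"
    "outer_side nr d = z_edge nr (Suc d)"
  using assms by (auto simp: shares_w_def new_edge_defs w_edge_def z_edge_def)

lemma outer_edges_eq: "{w_edge nr (Suc d), z_edge nr (Suc d)} = {opposite_edge nr d, outer_side nr d}"
  by (cases "shares_w nr d") (auto simp: shares_w_edges not_shares_w_edges)

lemma matching_avoids_new: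
  assumes "d \<ge> 1" "P \<in> matchings (snake_edges nr d)"
  shows "opposite_edge nr d \<notin> P" "outer_side nr d \<notin> P" "inner_side nr d \<notin> P"
  using matchingsD(1)[OF assms(2)] new_edges_fresh[OF assms(1), of nr] by auto

lemma shared_neq_new:
  assumes "d \<ge> 1"
  shows "shared_edge nr d \<noteq> opposite_edge nr d" "shared_edge nr d \<noteq> outer_side nr d"
    "shared_edge nr d \<noteq> inner_side nr d"
  using shared_edge_in[OF assms, of nr] new_edges_fresh[OF assms, of nr] by metis+

lemma matchings_Suc_cases:
  assumes "d \<ge> 1" "Q \<in> matchings (snake_edges nr (Suc d))"
  obtains (opposite) P where "P \<in> matchings (snake_edges nr d)" "Q = insert (opposite_edge nr d) P"
  | (sides) P where "P \<in> matchings (snake_edges nr d)" "shared_edge nr d \<in> P" "Q = swap_sides nr d P"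
  using assms(2) unfolding matchings_Suc[OF assms(1)] by blast

text \<open>The north-east corner of the last tile lies on these two edges only, so exactly one of
  them covers it.\<close>

lemma matching_outer_edge:
  assumes "d \<ge> 1" "P \<in> matchings (snake_edges nr d)"
  shows "w_edge nr d \<in> P \<longleftrightarrow> z_edge nr d \<notin> P"
proof (cases "d = 1")
  case True
  then show ?thesis using assms(2) unfolding True matchings_1 by (auto simp: w_edge_def z_edge_def)
next
  case False
  then obtain k where k: "d = Suc k" "k \<ge> 1" using assms(1) by (cases d) auto
  have "opposite_edge nr k \<in> P \<longleftrightarrow> outer_side nr k \<notin> P"
    using k(2) assms(2)[unfolded k(1)]
  proof (cases rule: matchings_Suc_cases)
    case (opposite P)
    then show ?thesis using matching_avoids_new[OF k(2) opposite(1)] new_edges_fresh(4)[OF k(2)] by auto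
  next
    case (sides P)
    then show ?thesis using matching_avoids_new[OF k(2) sides(1)] new_edges_fresh[OF k(2)]
      by (auto simp: swap_sides_def)
  qed
  then show ?thesis
    by (cases "shares_w nr k") (auto simp: k shares_w_edges not_shares_w_edges)
qed

text \<open>The edge is old, and it is never the shared edge: the latter reaches level
  \<open>d + 1\<close>, which is at least 2, while the south edge of the first tile ends on level 1.
  Hence growing the snake preserves how a matching starts.\<close>

lemma south_in_Suc_iff:
  assumes "d \<ge> 1"
  shows "south_e (0, 0) \<in> insert (opposite_edge nr d) P \<longleftrightarrow> south_e (0, 0) \<in> P"
    "south_e (0, 0) \<in> swap_sides nr d P \<longleftrightarrow> south_e (0, 0) \<in> P"
proof -
  have "south_e (0, 0) \<in> snake_edges nr d"
    using assms by (auto simp: snake_edges_def tile_edges_def intro!: bexI[of _ 1])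
  then have new: "south_e (0, 0) \<noteq> opposite_edge nr d" "south_e (0, 0) \<noteq> outer_side nr d"
    "south_e (0, 0) \<noteq> inner_side nr d"
    using new_edges_fresh[OF assms, of nr] by metis+
  have sh: "south_e (0, 0) \<noteq> shared_edge nr d"
  proof
    assume eq: "south_e (0, 0) = shared_edge nr d"
    have "(fst (tpos nr d) + 1, snd (tpos nr d) + 1) \<in> shared_edge nr d"
      by (simp add: shared_edge_def edge_defs)
    then show False
      using tpos_level[OF assms, of nr] assms unfolding eq[symmetric] by (auto simp: south_e_def)
  qed
  show "south_e (0, 0) \<in> insert (opposite_edge nr d) P \<longleftrightarrow> south_e (0, 0) \<in> P"
    "south_e (0, 0) \<in> swap_sides nr d P \<longleftrightarrow> south_e (0, 0) \<in> P"
    using new sh by (auto simp: swap_sides_def)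
qed

section \<open>The minimal matching and the enclosed tiles\<close>

lemma card_tiles_Suc:
  "card {j \<in> {1..Suc d}. Q j} = card {j \<in> {1..d}. Q j} + (if Q (Suc d) then 1 else 0)"
proof -
  have "{j \<in> {1..Suc d}. Q j} =
      (if Q (Suc d) then insert (Suc d) {j \<in> {1..d}. Q j} else {j \<in> {1..d}. Q j})"
    by (auto simp: le_Suc_eq)
  then show ?thesis by simp
qed

lemma boundary_edges_fresh:
  assumes "e \<in> tile_edges (tpos nr (Suc d))" "e \<notin> snake_edges nr d"
  shows "e \<in> boundary_edges nr (Suc d)"
proof -
  have "{j \<in> {1..d}. e \<in> tile_edges (tpos nr j)} = {}"
    using assms(2) by (auto simp: snake_edges_def)
  then show ?thesis
    using assms(1) card_tiles_Suc[of d "\<lambda>j. e \<in> tile_edges (tpos nr j)"]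
    by (simp add: boundary_edges_def snake_edges_Suc)
qed

text \<open>This edge contains the north-east corner of tile \<open>d\<close>, which is above the
  levels of all earlier tiles.\<close>

lemma shared_edge_boundary:
  assumes "d \<ge> 1"
  shows "shared_edge nr d \<in> boundary_edges nr d"
proof -
  obtain k where k: "d = Suc k" using assms by (cases d) auto
  have "(fst (tpos nr d) + 1, snd (tpos nr d) + 1) \<in> shared_edge nr d"
    by (simp add: shared_edge_def edge_defs)
  then have "shared_edge nr d \<notin> snake_edges nr k"
    using snake_vertex_level(1)[of "(fst (tpos nr d) + 1, snd (tpos nr d) + 1)" nr k]
      tpos_level[OF assms, of nr] k by auto
  then show ?thesis
    unfolding k using boundary_edges_fresh[of "shared_edge nr d" nr k]
    by (simp add: k shared_edge_def tile_edges_def split: if_splits)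
qed

text \<open>Among the old edges only the shared one gains a second tile; the three new edges lie on
  the new tile alone.\<close>

lemma boundary_edges_Suc:
  assumes "d \<ge> 1"
  shows "boundary_edges nr (Suc d) = boundary_edges nr d - {shared_edge nr d} \<union>
     {opposite_edge nr d, outer_side nr d, inner_side nr d}"
proof -
  let ?t = "\<lambda>e j. e \<in> tile_edges (tpos nr j)"
  have old: "e \<in> boundary_edges nr (Suc d) \<longleftrightarrow> e \<in> boundary_edges nr d \<and> e \<noteq> shared_edge nr d"
    if e: "e \<in> snake_edges nr d" for e
  proof -
    have last: "?t e (Suc d) \<longleftrightarrow> e = shared_edge nr d"
      using e new_edges_fresh[OF assms, of nr] unfolding tile_edges_new[OF assms] by auto
    have "e = shared_edge nr d \<Longrightarrow> card {j \<in> {1..d}. ?t e j} = 1"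
      using shared_edge_boundary[OF assms, of nr] by (simp add: boundary_edges_def)
    moreover have "e \<in> snake_edges nr (Suc d)" using e by (simp add: snake_edges_Suc)
    ultimately show ?thesis
      using e card_tiles_Suc[of d "?t e"] last by (auto simp: boundary_edges_def)
  qed
  have new: "{opposite_edge nr d, outer_side nr d, inner_side nr d} \<subseteq> boundary_edges nr (Suc d)"
    by (simp add: boundary_edges_fresh tile_edges_new[OF assms] new_edges_fresh[OF assms])
  show ?thesis
  proof (rule set_eqI)
    fix e
    show "e \<in> boundary_edges nr (Suc d) \<longleftrightarrow> e \<in> boundary_edges nr d - {shared_edge nr d} \<union>
       {opposite_edge nr d, outer_side nr d, inner_side nr d}"
    proof (cases "e \<in> snake_edges nr d")
      case True
      then have "e \<notin> {opposite_edge nr d, outer_side nr d, inner_side nr d}"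
        using new_edges_fresh(1-3)[OF assms, of nr] by fast
      then show ?thesis using old[OF True] by simp
    next
      case False
      then have "e \<notin> boundary_edges nr d" by (simp add: boundary_edges_def)
      moreover have "e \<in> {opposite_edge nr d, outer_side nr d, inner_side nr d}"
        if "e \<in> boundary_edges nr (Suc d)"
        using that False by (simp add: boundary_edges_def snake_edges_new[OF assms])
      ultimately show ?thesis using new by fast
    qed
  qed
qed

lemma boundary_edges_1: "boundary_edges nr 1 = tile_edges (0, 0)"
proof -
  have "{j \<in> {Suc 0..Suc 0}. e \<in> tile_edges (tpos nr j)} = (if e \<in> tile_edges (0, 0) then {1} else {})" for e
    by auto
  then show ?thesis by (auto simp: boundary_edges_def snake_edges_1[simplified])
qed

text \<open>The minimal matching contains the \<open>w\<close>-edge of every last tile, which dictates how it is extended.\<close>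

fun minimal :: "(nat \<Rightarrow> bool) \<Rightarrow> nat \<Rightarrow> edge set" where
  "minimal nr 0 = {}"
| "minimal nr (Suc 0) = {south_e (0, 0), north_e (0, 0)}"
| "minimal nr (Suc (Suc k)) =
     (if shares_w nr (Suc k) then swap_sides nr (Suc k) (minimal nr (Suc k))
      else insert (opposite_edge nr (Suc k)) (minimal nr (Suc k)))"

lemma minimal_Suc:
  "d \<ge> 1 \<Longrightarrow> minimal nr (Suc d) =
     (if shares_w nr d then swap_sides nr d (minimal nr d)
      else insert (opposite_edge nr d) (minimal nr d))"
  by (cases d) auto

text \<open>A shared \<open>w\<close>-edge belongs to the matching and becomes interior, so it has
  to be exchanged. A shared \<open>z\<close>-edge does not belong to it, and the opposite edge,
  which is the new \<open>w\<close>-edge, can be added.\<close>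

lemma minimal_props:
  assumes "d \<ge> 1"
  shows "minimal nr d \<in> matchings (snake_edges nr d) \<and> w_edge nr d \<in> minimal nr d \<and>
    minimal nr d \<subseteq> boundary_edges nr d \<and> south_e (0, 0) \<in> minimal nr d"
  using assms
proof (induction d rule: dec_induct)
  case base
  then show ?case
    using matchings_1[of nr] boundary_edges_1[of nr] by (simp add: w_edge_def tile_edges_def)
next
  case (step d)
  have d: "d \<ge> 1" using step by simp
  let ?m = "minimal nr d"
  have m: "?m \<in> matchings (snake_edges nr d)" "w_edge nr d \<in> ?m" "?m \<subseteq> boundary_edges nr d"
    "south_e (0, 0) \<in> ?m" using step.IH by auto
  have z: "z_edge nr d \<notin> ?m" using matching_outer_edge[OF d m(1)] m(2) by simp
  show ?case
  proof (cases "shares_w nr d")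
    case True
    have eq: "minimal nr (Suc d) = swap_sides nr d ?m" using True by (simp add: minimal_Suc[OF d])
    have "swap_sides nr d ?m \<in> matchings (snake_edges nr (Suc d))"
      using m(1,2) True by (simp add: matchings_Suc[OF d] shares_w_edges)
    moreover have "swap_sides nr d ?m \<subseteq> boundary_edges nr (Suc d)"
      using m(3) unfolding boundary_edges_Suc[OF d] swap_sides_def by fast
    moreover have "w_edge nr (Suc d) \<in> swap_sides nr d ?m"
      using True by (simp add: swap_sides_def shares_w_edges)
    ultimately show ?thesis
      unfolding eq using m(4) south_in_Suc_iff(2)[OF d] by blast
  next
    case False
    have eq: "minimal nr (Suc d) = insert (opposite_edge nr d) ?m" using False by (simp add: minimal_Suc[OF d])
    have "insert (opposite_edge nr d) ?m \<in> matchings (snake_edges nr (Suc d))"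
      using m(1) by (simp add: matchings_Suc[OF d])
    moreover have "shared_edge nr d \<notin> ?m" using z False by (simp add: not_shares_w_edges)
    then have "insert (opposite_edge nr d) ?m \<subseteq> boundary_edges nr (Suc d)"
      using m(3) unfolding boundary_edges_Suc[OF d] by fast
    moreover have "w_edge nr (Suc d) \<in> insert (opposite_edge nr d) ?m"
      using False by (simp add: not_shares_w_edges)
    ultimately show ?thesis
      unfolding eq using m(4) south_in_Suc_iff(1)[OF d] by blast
  qed
qed

text \<open>Stripping the last tile from \<open>Q\<close> gives a boundary matching of the shorter
  snake, hence the minimal one. Whether that one contains the shared edge decides how
  \<open>Q\<close> arose from it.\<close>

lemma minimal_unique:
  assumes "d \<ge> 1" "Q \<in> matchings (snake_edges nr d)" "Q \<subseteq> boundary_edges nr d" "south_e (0, 0) \<in> Q"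
  shows "Q = minimal nr d"
  using assms
proof (induction d arbitrary: Q rule: dec_induct)
  case base
  then have "Q = minimal nr 1 \<or> Q = {west_e (0, 0), east_e (0, 0)}"
    using matchings_1[of nr] by simp
  then show ?case using base(3) by (elim disjE) simp_all
next
  case (step d)
  have d: "d \<ge> 1" using step by simp
  have w: "w_edge nr d \<in> minimal nr d" and z: "z_edge nr d \<notin> minimal nr d"
    using minimal_props[OF d, of nr] matching_outer_edge[OF d, of "minimal nr d" nr] by simp_all
  have sh: "shared_edge nr d \<notin> Q"
  proof
    assume "shared_edge nr d \<in> Q"
    then have "shared_edge nr d \<in> boundary_edges nr (Suc d)" using step.prems(2) by fast
    then show False using shared_neq_new[OF d, of nr] by (simp add: boundary_edges_Suc[OF d])
  qed
  from d step.prems(1) show ?case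
  proof (cases rule: matchings_Suc_cases)
    case (opposite P)
    have "P \<subseteq> boundary_edges nr d"
    proof
      fix e assume e: "e \<in> P"
      then have "e \<notin> {opposite_edge nr d, outer_side nr d, inner_side nr d}"
        using matching_avoids_new[OF d opposite(1)] by fast
      then show "e \<in> boundary_edges nr d"
        using e step.prems(2) opposite(2) unfolding boundary_edges_Suc[OF d] by fast
    qed
    moreover have "south_e (0, 0) \<in> P"
      using step.prems(3) opposite south_in_Suc_iff(1)[OF d, where nr = nr and P = P] by simp
    ultimately have P: "P = minimal nr d" using step.IH opposite(1) by blast
    then have "\<not> shares_w nr d" using sh w opposite(2) shares_w_edges(1)[of nr d] by fastforce
    then show ?thesis using P opposite(2) by (simp add: minimal_Suc[OF d])
  next
    case (sides P)
    have "P \<subseteq> boundary_edges nr d"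
    proof
      fix e assume e: "e \<in> P"
      show "e \<in> boundary_edges nr d"
      proof (cases "e = shared_edge nr d")
        case True
        then show ?thesis using shared_edge_boundary[OF d] by simp
      next
        case False
        have "e \<notin> {opposite_edge nr d, outer_side nr d, inner_side nr d}"
          using e matching_avoids_new[OF d sides(1)] by fast
        moreover have "e \<in> Q" using e False sides(3) by (simp add: swap_sides_def)
        ultimately show ?thesis using step.prems(2) unfolding boundary_edges_Suc[OF d] by fast
      qed
    qed
    moreover have "south_e (0, 0) \<in> P"
      using step.prems(3) sides south_in_Suc_iff(2)[OF d, where nr = nr and P = P] by simp
    ultimately have P: "P = minimal nr d" using step.IH sides(1) by blast
    then have "shares_w nr d" using z sides(2) not_shares_w_edges(1) by metis
    then show ?thesis using P sides(3) by (simp add: minimal_Suc[OF d])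
  qed
qed

lemma min_matching_eq: "d \<ge> 1 \<Longrightarrow> min_matching nr d = minimal nr d"
  unfolding min_matching_def perfect_matching_iff
  using minimal_props[of d nr] minimal_unique[of d _ nr] by (intro the_equality) auto

text \<open>The index \<open>j\<close> has no upper bound, so that the sets for \<open>d\<close> and
  \<open>d + 1\<close> can be compared directly; \<open>enclosed_tiles_subset\<close> supplies the
  bound.\<close>

definition enclosed_tiles :: "(nat \<Rightarrow> bool) \<Rightarrow> nat \<Rightarrow> edge set \<Rightarrow> nat set" where
  "enclosed_tiles nr d P = {j. j \<ge> 1 \<and> tile_enclosed (sym_diff P (minimal nr d)) (tpos nr j)}"

lemma finite_matching: "P \<in> matchings (snake_edges nr d) \<Longrightarrow> finite P"
  using finite_subset finite_snake_edges matchingsD(1) by metis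

lemma enclosed_tiles_1:
  "enclosed_tiles nr 1 {south_e (0, 0), north_e (0, 0)} = {}"
  "enclosed_tiles nr 1 {west_e (0, 0), east_e (0, 0)} = {1}"
proof -
  have empty: "\<not> tile_enclosed {} p" for p by (simp add: tile_enclosed_def)
  show "enclosed_tiles nr 1 {south_e (0, 0), north_e (0, 0)} = {}"
    by (simp add: enclosed_tiles_def empty)
  \<comment> \<open>The two matchings of the first tile are disjoint and together form its whole
    boundary.\<close>
  have D: "sym_diff {west_e (0, 0), east_e (0, 0)} (minimal nr 1) = sym_diff {} (tile_edges (tpos nr 1))"
    by (auto simp: tile_edges_def)
  have "tile_enclosed (sym_diff {} (tile_edges q)) p \<longleftrightarrow> p = q" for p q
    by (subst tile_enclosed_sym_diff_tile) (simp_all add: empty)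
  then show "enclosed_tiles nr 1 {west_e (0, 0), east_e (0, 0)} = {1}"
    unfolding enclosed_tiles_def D using tpos_inj[of _ 1 nr] by auto
qed

text \<open>Modulo 2, one way of extending adds \<open>op\<close>, the other adds \<open>sh\<close>,
  \<open>sd\<close> and \<open>t\<close>. If \<open>P\<close> and \<open>m\<close> are extended
  alike, these cancel; otherwise they sum to all four sides.\<close>

lemma sym_diff_glue_square:
  assumes "op \<notin> P" "sd \<notin> P" "t \<notin> P" "op \<notin> m" "sd \<notin> m" "t \<notin> m"
    "op \<noteq> sd" "op \<noteq> t" "sd \<noteq> t" "sh \<noteq> op" "sh \<noteq> sd" "sh \<noteq> t"
  shows "sh \<in> m \<Longrightarrow>
      sym_diff (insert op P) (m - {sh} \<union> {sd, t}) = sym_diff (sym_diff P m) {sh, op, sd, t}"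
    "sh \<in> m \<Longrightarrow> sh \<in> P \<Longrightarrow>
      sym_diff (P - {sh} \<union> {sd, t}) (m - {sh} \<union> {sd, t}) = sym_diff P m"
    "sym_diff (insert op P) (insert op m) = sym_diff P m"
    "sh \<notin> m \<Longrightarrow> sh \<in> P \<Longrightarrow>
      sym_diff (P - {sh} \<union> {sd, t}) (insert op m) = sym_diff (sym_diff P m) {sh, op, sd, t}"
  using assms by auto

text \<open>The minimal matching ends in the \<open>w\<close>-edge, so \<open>Q\<close> contains the
  \<open>z\<close>-edge exactly if it was extended differently. Then the difference changes by the
  four edges of the new tile, which flips the status of this tile only; by the last hypothesis it
  flips to enclosed.\<close>

lemma enclosed_tiles_Suc:
  assumes d: "d \<ge> 1" and P: "P \<in> matchings (snake_edges nr d)"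
    and Q: "Q = insert (opposite_edge nr d) P \<or> shared_edge nr d \<in> P \<and> Q = swap_sides nr d P"
    and no: "Suc d \<notin> enclosed_tiles nr d P"
  shows "enclosed_tiles nr (Suc d) Q =
    enclosed_tiles nr d P \<union> (if z_edge nr (Suc d) \<in> Q then {Suc d} else {})"
proof -
  let ?m = "minimal nr d"
  have m: "?m \<in> matchings (snake_edges nr d)" "w_edge nr d \<in> ?m" and z: "z_edge nr d \<notin> ?m"
    using minimal_props[OF d, of nr] matching_outer_edge[OF d, of ?m nr] by auto
  have fin: "finite (sym_diff P ?m)" using finite_matching P m by blast
  note fresh = matching_avoids_new[OF d P] matching_avoids_new[OF d m(1)]
    new_edges_fresh(4-6)[OF d, of nr] shared_neq_new[OF d, of nr]
  have D: "sym_diff Q (minimal nr (Suc d)) =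
    (if z_edge nr (Suc d) \<in> Q then sym_diff (sym_diff P ?m) (tile_edges (tpos nr (Suc d)))
     else sym_diff P ?m)"
  proof (cases "shares_w nr d")
    case True
    have sh: "shared_edge nr d \<in> ?m" using m(2) True by (simp add: shares_w_edges)
    have eq: "minimal nr (Suc d) = ?m - {shared_edge nr d} \<union> {outer_side nr d, inner_side nr d}"
      "z_edge nr (Suc d) = opposite_edge nr d"
      using True by (simp_all add: minimal_Suc[OF d] swap_sides_def shares_w_edges)
    from Q show ?thesis
    proof (elim disjE conjE)
      assume Q: "Q = insert (opposite_edge nr d) P"
      show ?thesis
        unfolding eq Q tile_edges_new[OF d] using sym_diff_glue_square(1)[OF fresh sh] by simp
    next
      assume P: "shared_edge nr d \<in> P" and Q: "Q = swap_sides nr d P"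
      have "opposite_edge nr d \<notin> swap_sides nr d P" using fresh by (simp add: swap_sides_def)
      then show ?thesis
        unfolding eq Q using sym_diff_glue_square(2)[OF fresh sh P] fresh(1) by (simp add: swap_sides_def)
    qed
  next
    case False
    have sh: "shared_edge nr d \<notin> ?m" using z False by (simp add: not_shares_w_edges)
    have eq: "minimal nr (Suc d) = insert (opposite_edge nr d) ?m"
      "z_edge nr (Suc d) = outer_side nr d"
      using False by (simp_all add: minimal_Suc[OF d] not_shares_w_edges)
    from Q show ?thesis
    proof (elim disjE conjE)
      assume Q: "Q = insert (opposite_edge nr d) P"
      have "outer_side nr d \<notin> insert (opposite_edge nr d) P" using fresh by simp
      then show ?thesis
        unfolding eq Q using sym_diff_glue_square(3)[OF fresh] by simp
    next
      assume P: "shared_edge nr d \<in> P" and Q: "Q = swap_sides nr d P"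
      show ?thesis
        unfolding eq Q tile_edges_new[OF d] using sym_diff_glue_square(4)[OF fresh sh P]
        by (simp add: swap_sides_def)
    qed
  qed
  have "j \<in> enclosed_tiles nr (Suc d) Q \<longleftrightarrow>
      j \<in> enclosed_tiles nr d P \<union> (if z_edge nr (Suc d) \<in> Q then {Suc d} else {})" for j
  proof (cases "z_edge nr (Suc d) \<in> Q")
    case True
    then show ?thesis
      using no tpos_inj[of j "Suc d" nr] unfolding enclosed_tiles_def D
      by (auto simp: tile_enclosed_sym_diff_tile[OF fin] simp del: tpos.simps)
  next
    case False
    then show ?thesis unfolding enclosed_tiles_def D by simp
  qed
  then show ?thesis by blast
qed

text \<open>The bound for \<open>d\<close> is just the hypothesis that
  \<open>enclosed_tiles_Suc\<close> needs for the step to \<open>d + 1\<close>.\<close>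

lemma enclosed_tiles_subset:
  assumes "d \<ge> 1" "P \<in> matchings (snake_edges nr d)"
  shows "enclosed_tiles nr d P \<subseteq> {1..d} \<and> (d \<in> enclosed_tiles nr d P \<longleftrightarrow> z_edge nr d \<in> P)"
  using assms
proof (induction d arbitrary: P rule: dec_induct)
  case base
  then consider "P = {south_e (0, 0), north_e (0, 0)}" | "P = {west_e (0, 0), east_e (0, 0)}"
    using matchings_1[of nr] by auto
  then show ?case
    by cases (use enclosed_tiles_1[of nr] in \<open>auto simp: z_edge_def\<close>)
next
  case (step d Q)
  have d: "d \<ge> 1" using step by simp
  obtain P where P: "P \<in> matchings (snake_edges nr d)"
    "Q = insert (opposite_edge nr d) P \<or> shared_edge nr d \<in> P \<and> Q = swap_sides nr d P"
    using d step.prems by (cases rule: matchings_Suc_cases) auto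
  have sub: "enclosed_tiles nr d P \<subseteq> {1..d}" using step.IH[OF P(1)] by simp
  then have "Suc d \<notin> enclosed_tiles nr d P" by auto
  then show ?case using sub enclosed_tiles_Suc[OF d P] by auto
qed

section \<open>Generating functions by the state of the last tile\<close>

text \<open>The two outer edges of the last tile are left out of the inner weight, and the last tile out of
  the inner height, because their contributions are only fixed by the next tile.\<close>

definition inner_weight :: "(nat \<Rightarrow> bool) \<Rightarrow> (edge \<Rightarrow> 'a::comm_ring_1) \<Rightarrow> nat \<Rightarrow> edge set \<Rightarrow> 'a" where
  "inner_weight nr \<omega> d P = prod \<omega> (P - {w_edge nr d, z_edge nr d})"

definition inner_height :: "(nat \<Rightarrow> bool) \<Rightarrow> (nat \<Rightarrow> 'a::comm_ring_1) \<Rightarrow> nat \<Rightarrow> edge set \<Rightarrow> 'a" where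
  "inner_height nr \<eta> d P = prod \<eta> (enclosed_tiles nr d P - {d})"

text \<open>Edge weights \<open>\<omega>\<close> and tile weights \<open>\<eta>\<close> are
  arbitrary here: the labels depend on the final length of the snake, while the recursion runs over
  its initial pieces.\<close>

definition full_weight ::
  "(nat \<Rightarrow> bool) \<Rightarrow> (edge \<Rightarrow> 'a::comm_ring_1) \<Rightarrow> (nat \<Rightarrow> 'a) \<Rightarrow> nat \<Rightarrow> edge set \<Rightarrow> 'a" where
  "full_weight nr \<omega> \<eta> d P = prod \<omega> P * prod \<eta> (enclosed_tiles nr d P)"

text \<open>The flag \<open>s\<close> tells which of the two edges at the south-west corner of the
  first tile is used, and thereby selects a column of the matrix product.\<close>

definition start_matchings :: "(nat \<Rightarrow> bool) \<Rightarrow> bool \<Rightarrow> nat \<Rightarrow> edge set set" where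
  "start_matchings nr s d = {P \<in> matchings (snake_edges nr d). south_e (0, 0) \<in> P \<longleftrightarrow> s}"

text \<open>With \<open>e\<close> the \<open>w\<close>-edge or the \<open>z\<close>-edge of tile
  \<open>d\<close>, these are the two coordinates of the transfer vector before
  normalisation.\<close>

definition state_sum ::
  "(nat \<Rightarrow> bool) \<Rightarrow> (edge \<Rightarrow> 'a::comm_ring_1) \<Rightarrow> (nat \<Rightarrow> 'a) \<Rightarrow> bool \<Rightarrow> nat \<Rightarrow> edge \<Rightarrow> 'a" where
  "state_sum nr \<omega> \<eta> s d e =
     (\<Sum>P\<in>{P \<in> start_matchings nr s d. e \<in> P}. inner_weight nr \<omega> d P * inner_height nr \<eta> d P)"

lemma finite_start_matchings: "finite (start_matchings nr s d)"
  by (simp add: start_matchings_def finite_matchings)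

lemma prod_enclosed_tiles:
  assumes "d \<ge> 1" "P \<in> matchings (snake_edges nr d)"
  shows "prod \<eta> (enclosed_tiles nr d P) = inner_height nr \<eta> d P * (if z_edge nr d \<in> P then \<eta> d else 1)"
proof -
  have "enclosed_tiles nr d P \<subseteq> {1..d}" using enclosed_tiles_subset[OF assms] by simp
  then have "finite (enclosed_tiles nr d P)" using finite_subset by blast
  then show ?thesis
    using enclosed_tiles_subset[OF assms] by (simp add: inner_height_def prod.remove mult.commute)
qed

text \<open>Exactly one outer edge is in the matching, and tile \<open>d\<close> is enclosed exactly
  if it is the \<open>z\<close>-edge; the last factor restores what the inner quantities
  omit.\<close>

lemma full_weight_eq:
  assumes "d \<ge> 1" "P \<in> matchings (snake_edges nr d)"
  shows "full_weight nr \<omega> \<eta> d P = inner_weight nr \<omega> d P * inner_height nr \<eta> d P *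
    (if z_edge nr d \<in> P then \<omega> (z_edge nr d) * \<eta> d else \<omega> (w_edge nr d))"
proof -
  have fin: "finite P" using finite_matching[OF assms(2)] .
  have "prod \<omega> P = inner_weight nr \<omega> d P *
    (if z_edge nr d \<in> P then \<omega> (z_edge nr d) else \<omega> (w_edge nr d))"
  proof (cases "z_edge nr d \<in> P")
    case True
    then have "w_edge nr d \<notin> P" using matching_outer_edge[OF assms] by simp
    then have "P - {w_edge nr d, z_edge nr d} = P - {z_edge nr d}" by (simp add: Diff_insert0)
    then show ?thesis using True fin by (simp add: inner_weight_def prod.remove mult.commute)
  next
    case False
    then have "w_edge nr d \<in> P" using matching_outer_edge[OF assms] by simp
    moreover have "P - {w_edge nr d, z_edge nr d} = P - {w_edge nr d}"
      using False by (simp add: Diff_insert0 insert_commute[of "w_edge nr d"])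
    ultimately show ?thesis using False fin by (simp add: inner_weight_def prod.remove mult.commute)
  qed
  then show ?thesis
    by (simp add: full_weight_def prod_enclosed_tiles[OF assms] ac_simps)
qed

lemma full_weight_sum_z:
  assumes "d \<ge> 1"
  shows "(\<Sum>P\<in>{P \<in> start_matchings nr s d. z_edge nr d \<in> P}. full_weight nr \<omega> \<eta> d P) =
    \<omega> (z_edge nr d) * \<eta> d * state_sum nr \<omega> \<eta> s d (z_edge nr d)"
  unfolding state_sum_def sum_distrib_left
  by (rule sum.cong[OF refl]) (simp add: start_matchings_def full_weight_eq[OF assms] ac_simps)

lemma full_weight_sum:
  assumes "d \<ge> 1"
  shows "(\<Sum>P\<in>start_matchings nr s d. full_weight nr \<omega> \<eta> d P) =
    \<omega> (w_edge nr d) * state_sum nr \<omega> \<eta> s d (w_edge nr d) +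
    \<omega> (z_edge nr d) * \<eta> d * state_sum nr \<omega> \<eta> s d (z_edge nr d)"
proof -
  let ?W = "{P \<in> start_matchings nr s d. w_edge nr d \<in> P}"
  let ?Z = "{P \<in> start_matchings nr s d. z_edge nr d \<in> P}"
  have iff: "w_edge nr d \<in> P \<longleftrightarrow> z_edge nr d \<notin> P" if "P \<in> start_matchings nr s d" for P
    using matching_outer_edge[OF assms] that by (simp add: start_matchings_def)
  have un: "start_matchings nr s d = ?W \<union> ?Z" and disj: "?W \<inter> ?Z = {}" using iff by fast+
  have "(\<Sum>P\<in>start_matchings nr s d. full_weight nr \<omega> \<eta> d P) =
    sum (full_weight nr \<omega> \<eta> d) ?W + sum (full_weight nr \<omega> \<eta> d) ?Z"
    by (subst un, rule sum.union_disjoint) (use disj finite_start_matchings in auto)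
  moreover have "sum (full_weight nr \<omega> \<eta> d) ?W =
    \<omega> (w_edge nr d) * state_sum nr \<omega> \<eta> s d (w_edge nr d)"
    unfolding state_sum_def sum_distrib_left
  proof (rule sum.cong[OF refl])
    fix P assume P: "P \<in> ?W"
    then have "z_edge nr d \<notin> P" "P \<in> matchings (snake_edges nr d)"
      using iff[of P] by (simp_all add: start_matchings_def)
    then show "full_weight nr \<omega> \<eta> d P =
        \<omega> (w_edge nr d) * (inner_weight nr \<omega> d P * inner_height nr \<eta> d P)"
      by (simp add: full_weight_eq[OF assms] ac_simps)
  qed
  ultimately show ?thesis by (simp only: full_weight_sum_z[OF assms])
qed

section \<open>Recursion for the state sums\<close>

lemma inner_height_Suc:
  assumes "d \<ge> 1" "P \<in> matchings (snake_edges nr d)"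
    and "Q = insert (opposite_edge nr d) P \<or> shared_edge nr d \<in> P \<and> Q = swap_sides nr d P"
  shows "inner_height nr \<eta> (Suc d) Q = prod \<eta> (enclosed_tiles nr d P)"
proof -
  have no: "Suc d \<notin> enclosed_tiles nr d P" using enclosed_tiles_subset[OF assms(1,2)] by auto
  then have "enclosed_tiles nr (Suc d) Q - {Suc d} = enclosed_tiles nr d P"
    using enclosed_tiles_Suc[OF assms no] by auto
  then show ?thesis by (simp add: inner_height_def)
qed

text \<open>The added edge is an outer edge of the new tile and is left out, whereas all edges of
  \<open>P\<close> now count.\<close>

lemma inner_weight_opposite:
  assumes "d \<ge> 1" "P \<in> matchings (snake_edges nr d)"
  shows "inner_weight nr \<omega> (Suc d) (insert (opposite_edge nr d) P) = prod \<omega> P"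
proof -
  have "insert (opposite_edge nr d) P - {w_edge nr (Suc d), z_edge nr (Suc d)} = P"
    unfolding outer_edges_eq using matching_avoids_new[OF assms] by (simp add: Diff_insert0)
  then show ?thesis by (simp add: inner_weight_def)
qed

text \<open>Of the two added sides, the outer one is left out; the removed shared edge was an outer
  edge of tile \<open>d\<close> and had not been counted.\<close>

lemma inner_weight_sides:
  assumes "d \<ge> 1" "P \<in> matchings (snake_edges nr d)" "shared_edge nr d \<in> P"
  shows "inner_weight nr \<omega> (Suc d) (swap_sides nr d P) = \<omega> (inner_side nr d) * inner_weight nr \<omega> d P"
proof -
  note fresh = matching_avoids_new[OF assms(1,2)] new_edges_fresh(4-6)[OF assms(1), of nr]
  have "swap_sides nr d P - {opposite_edge nr d, outer_side nr d} =
    insert (inner_side nr d) (P - {shared_edge nr d})"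
    using fresh unfolding swap_sides_def by (auto simp only:)
  \<comment> \<open>The shared edge is one outer edge of tile \<open>d\<close>, and \<open>P\<close>
    does not contain the other one.\<close>
  moreover have "P - {shared_edge nr d} = P - {w_edge nr d, z_edge nr d}"
  proof (cases "shares_w nr d")
    case True
    then show ?thesis
      using assms(3) matching_outer_edge[OF assms(1,2)]
      by (simp add: shares_w_edges insert_commute[of "w_edge nr d"] Diff_insert0)
  next
    case False
    then show ?thesis
      using assms(3) matching_outer_edge[OF assms(1,2)]
      by (simp add: not_shares_w_edges Diff_insert0)
  qed
  ultimately have "swap_sides nr d P - {w_edge nr (Suc d), z_edge nr (Suc d)} =
    insert (inner_side nr d) (P - {w_edge nr d, z_edge nr d})"
    by (simp only: outer_edges_eq)
  then show ?thesis
    using fresh(3) finite_matching[OF assms(2)] by (simp add: inner_weight_def)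
qed

lemma state_sum_opposite:
  assumes d: "d \<ge> 1"
  shows "state_sum nr \<omega> \<eta> s (Suc d) (opposite_edge nr d) =
    (\<Sum>P\<in>start_matchings nr s d. full_weight nr \<omega> \<eta> d P)"
proof -
  let ?f = "insert (opposite_edge nr d)"
  have M: "P \<in> matchings (snake_edges nr d)" if "P \<in> start_matchings nr s d" for P
    using that by (simp add: start_matchings_def)
  have "{Q \<in> start_matchings nr s (Suc d). opposite_edge nr d \<in> Q} = ?f ` start_matchings nr s d"
  proof (intro set_eqI iffI)
    fix Q assume Q: "Q \<in> {Q \<in> start_matchings nr s (Suc d). opposite_edge nr d \<in> Q}"
    then have "Q \<in> matchings (snake_edges nr (Suc d))" by (simp add: start_matchings_def)
    with d show "Q \<in> ?f ` start_matchings nr s d"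
    proof (cases rule: matchings_Suc_cases)
      case (opposite P)
      then have "P \<in> start_matchings nr s d"
        using Q south_in_Suc_iff(1)[OF d, where nr = nr and P = P] by (simp add: start_matchings_def)
      then show ?thesis using opposite(2) by blast
    next
      case (sides P)
      then show ?thesis
        using Q matching_avoids_new(1)[OF d sides(1)] new_edges_fresh(4,5)[OF d, of nr]
        by (simp add: swap_sides_def)
    qed
  next
    fix Q assume "Q \<in> ?f ` start_matchings nr s d"
    then obtain P where P: "P \<in> start_matchings nr s d" "Q = ?f P" by blast
    then show "Q \<in> {Q \<in> start_matchings nr s (Suc d). opposite_edge nr d \<in> Q}"
      using south_in_Suc_iff(1)[OF d, where nr = nr and P = P]
      by (simp add: start_matchings_def matchings_Suc[OF d])
  qed
  moreover have "inj_on ?f (start_matchings nr s d)"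
    by (rule inj_onI) (metis insert_ident M matching_avoids_new(1)[OF d])
  moreover have "inner_height nr \<eta> (Suc d) (?f P) = prod \<eta> (enclosed_tiles nr d P)"
    if "P \<in> start_matchings nr s d" for P
    by (rule inner_height_Suc[OF d M[OF that]]) simp
  ultimately show ?thesis
    unfolding state_sum_def
    by (simp add: sum.reindex M inner_weight_opposite[OF d] full_weight_def cong: sum.cong)
qed

text \<open>The exchange is invertible on matchings through the shared edge. The tile
  \<open>d\<close> becomes part of the inner height, and it is enclosed exactly if the shared edge
  is its \<open>z\<close>-edge.\<close>

lemma state_sum_sides:
  assumes d: "d \<ge> 1"
  shows "state_sum nr \<omega> \<eta> s (Suc d) (outer_side nr d) =
    \<omega> (inner_side nr d) * (if shares_w nr d then 1 else \<eta> d) *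
      state_sum nr \<omega> \<eta> s d (shared_edge nr d)"
proof -
  let ?f = "swap_sides nr d" and ?S = "{P \<in> start_matchings nr s d. shared_edge nr d \<in> P}"
  have M: "P \<in> matchings (snake_edges nr d)" if "P \<in> start_matchings nr s d" for P
    using that by (simp add: start_matchings_def)
  have "{Q \<in> start_matchings nr s (Suc d). outer_side nr d \<in> Q} = ?f ` ?S"
  proof (intro set_eqI iffI)
    fix Q assume Q: "Q \<in> {Q \<in> start_matchings nr s (Suc d). outer_side nr d \<in> Q}"
    then have "Q \<in> matchings (snake_edges nr (Suc d))" by (simp add: start_matchings_def)
    with d show "Q \<in> ?f ` ?S"
    proof (cases rule: matchings_Suc_cases)
      case (opposite P)
      then show ?thesis
        using Q matching_avoids_new(2)[OF d opposite(1)] new_edges_fresh(4)[OF d, of nr] by simp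
    next
      case (sides P)
      then have "P \<in> ?S"
        using Q south_in_Suc_iff(2)[OF d, where nr = nr and P = P] by (simp add: start_matchings_def)
      then show ?thesis using sides(3) by blast
    qed
  next
    fix Q assume "Q \<in> ?f ` ?S"
    then obtain P where P: "P \<in> start_matchings nr s d" "shared_edge nr d \<in> P" "Q = ?f P" by blast
    then have "Q \<in> matchings (snake_edges nr (Suc d))" using M by (simp add: matchings_Suc[OF d])
    moreover have "outer_side nr d \<in> Q" using P by (simp add: swap_sides_def)
    ultimately show "Q \<in> {Q \<in> start_matchings nr s (Suc d). outer_side nr d \<in> Q}"
      using P south_in_Suc_iff(2)[OF d, where nr = nr and P = P] by (simp add: start_matchings_def)
  qed
  moreover have "inj_on ?f ?S"
  proof (rule inj_on_inverseI)
    fix P assume P: "P \<in> ?S"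
    then have "outer_side nr d \<notin> P" "inner_side nr d \<notin> P"
      using matching_avoids_new[OF d M] by simp_all
    then have "?f P - {outer_side nr d, inner_side nr d} = P - {shared_edge nr d}"
      by (simp add: swap_sides_def Diff_insert0)
    then show "insert (shared_edge nr d) (?f P - {outer_side nr d, inner_side nr d}) = P"
      using P by (simp add: insert_absorb)
  qed
  ultimately have "state_sum nr \<omega> \<eta> s (Suc d) (outer_side nr d) =
    (\<Sum>P\<in>?S. inner_weight nr \<omega> (Suc d) (?f P) * inner_height nr \<eta> (Suc d) (?f P))"
    unfolding state_sum_def by (simp add: sum.reindex)
  also have "\<dots> = (\<Sum>P\<in>?S. \<omega> (inner_side nr d) * (if shares_w nr d then 1 else \<eta> d) *
    (inner_weight nr \<omega> d P * inner_height nr \<eta> d P))"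
  proof (rule sum.cong[OF refl])
    fix P assume P: "P \<in> ?S"
    then have Pm: "P \<in> matchings (snake_edges nr d)" and sh: "shared_edge nr d \<in> P"
      using M by simp_all
    have "z_edge nr d \<in> P \<longleftrightarrow> \<not> shares_w nr d"
      using sh matching_outer_edge[OF d Pm] shares_w_edges(1)[of nr d] not_shares_w_edges(1)[of nr d]
      by metis
    then show "inner_weight nr \<omega> (Suc d) (?f P) * inner_height nr \<eta> (Suc d) (?f P) =
      \<omega> (inner_side nr d) * (if shares_w nr d then 1 else \<eta> d) *
        (inner_weight nr \<omega> d P * inner_height nr \<eta> d P)"
      using sh inner_height_Suc[OF d Pm, where Q = "?f P" and \<eta> = \<eta>]
        inner_weight_sides[OF d Pm sh, where \<omega> = \<omega>]
      by (simp add: prod_enclosed_tiles[OF d Pm] ac_simps)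
  qed
  finally show ?thesis by (simp add: state_sum_def sum_distrib_left)
qed

text \<open>The coordinate of the opposite edge collects both old coordinates, that of the outer
  side only the one of the shared edge. This makes \<open>m_j\<close> triangular.\<close>

lemma state_sum_Suc:
  assumes "d \<ge> 1"
  shows "shares_w nr d \<Longrightarrow> state_sum nr \<omega> \<eta> s (Suc d) (w_edge nr (Suc d)) =
      \<omega> (inner_side nr d) * state_sum nr \<omega> \<eta> s d (w_edge nr d)"
    "\<not> shares_w nr d \<Longrightarrow> state_sum nr \<omega> \<eta> s (Suc d) (z_edge nr (Suc d)) =
      \<omega> (inner_side nr d) * \<eta> d * state_sum nr \<omega> \<eta> s d (z_edge nr d)"
    "state_sum nr \<omega> \<eta> s (Suc d) (if shares_w nr d then z_edge nr (Suc d) else w_edge nr (Suc d)) =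
      \<omega> (w_edge nr d) * state_sum nr \<omega> \<eta> s d (w_edge nr d) +
      \<omega> (z_edge nr d) * \<eta> d * state_sum nr \<omega> \<eta> s d (z_edge nr d)"
  using state_sum_sides[OF assms, where nr = nr and \<omega> = \<omega> and \<eta> = \<eta> and s = s]
    state_sum_opposite[OF assms, where nr = nr and \<omega> = \<omega> and \<eta> = \<eta> and s = s]
    full_weight_sum[OF assms, where nr = nr and \<omega> = \<omega> and \<eta> = \<eta> and s = s]
  by (cases "shares_w nr d"; simp add: shares_w_edges not_shares_w_edges)+

text \<open>Both outer edges and the tile itself are left out, so only the edge at the south-west
  corner contributes.\<close>

lemma state_sum_1:
  "state_sum nr \<omega> \<eta> True 1 (w_edge nr 1) = \<omega> (south_e (0, 0))"
  "state_sum nr \<omega> \<eta> True 1 (z_edge nr 1) = 0"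
  "state_sum nr \<omega> \<eta> False 1 (w_edge nr 1) = 0"
  "state_sum nr \<omega> \<eta> False 1 (z_edge nr 1) = \<omega> (west_e (0, 0))"
proof -
  let ?A = "{south_e (0, 0), north_e (0, 0)}" and ?B = "{west_e (0, 0), east_e (0, 0)}"
  have w: "w_edge nr 1 = north_e (0, 0)" and z: "z_edge nr 1 = east_e (0, 0)"
    by (simp_all add: w_edge_def z_edge_def)
  have T: "start_matchings nr True 1 = {?A}"
    unfolding start_matchings_def matchings_1 by (intro set_eqI) (use edge_eq_iff in \<open>fastforce\<close>)
  have F: "start_matchings nr False 1 = {?B}"
    unfolding start_matchings_def matchings_1 by (intro set_eqI) (use edge_eq_iff in \<open>fastforce\<close>)
  have wA: "inner_weight nr \<omega> 1 ?A * inner_height nr \<eta> 1 ?A = \<omega> (south_e (0, 0))"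
    unfolding inner_weight_def inner_height_def w z enclosed_tiles_1 by (simp add: insert_Diff_if)
  have wB: "inner_weight nr \<omega> 1 ?B * inner_height nr \<eta> 1 ?B = \<omega> (west_e (0, 0))"
    unfolding inner_weight_def inner_height_def w z enclosed_tiles_1 by (simp add: insert_Diff_if)
  have sets: "{P \<in> {?A}. north_e (0, 0) \<in> P} = {?A}" "{P \<in> {?A}. east_e (0, 0) \<in> P} = {}"
    "{P \<in> {?B}. north_e (0, 0) \<in> P} = {}" "{P \<in> {?B}. east_e (0, 0) \<in> P} = {?B}"
    by (simp_all add: Collect_conv_if)
  show "state_sum nr \<omega> \<eta> True 1 (w_edge nr 1) = \<omega> (south_e (0, 0))"
    "state_sum nr \<omega> \<eta> True 1 (z_edge nr 1) = 0"
    "state_sum nr \<omega> \<eta> False 1 (w_edge nr 1) = 0"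
    "state_sum nr \<omega> \<eta> False 1 (z_edge nr 1) = \<omega> (west_e (0, 0))"
    unfolding state_sum_def T F w z sets
    by (simp_all only: wA wB sum.empty sum.insert finite.emptyI empty_iff not_False_eq_True add_0_right)
qed

section \<open>Edge labels\<close>

definition edge_level :: "edge \<Rightarrow> int" where
  "edge_level e = Min ((\<lambda>v. fst v + snd v) ` e)"

lemma edge_level_simps:
  "edge_level (south_e p) = fst p + snd p" "edge_level (west_e p) = fst p + snd p"
  "edge_level (north_e p) = fst p + snd p + 1" "edge_level (east_e p) = fst p + snd p + 1"
  by (simp_all add: edge_level_def edge_defs)

text \<open>Sorts the labelling by \<open>edge_level\<close>: edges from different groups cannot
  coincide, so a label is well defined once each single group is consistent.\<close>

definition level_labels ::
  "(nat \<Rightarrow> bool) \<Rightarrow> nat \<Rightarrow> 'l \<Rightarrow> (nat \<Rightarrow> 'l) \<Rightarrow> (nat \<Rightarrow> 'l) \<Rightarrow> nat \<Rightarrow> (edge \<times> 'l) set" where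
  "level_labels nr d a aa i j =
     (if j = 0 then {(south_e (0, 0), a), (west_e (0, 0), i d)}
      else if j < d then
        (if nr j
          then {(north_e (tpos nr j), aa j), (east_e (tpos nr j), i (j + 1)),
                (west_e (tpos nr (j + 1)), i j)}
          else {(east_e (tpos nr j), aa j), (north_e (tpos nr j), i (j + 1)),
                (south_e (tpos nr (j + 1)), i j)})
      else (if odd d then {(north_e (tpos nr d), i 1), (east_e (tpos nr d), a)}
        else {(east_e (tpos nr d), i 1), (north_e (tpos nr d), a)}))"

lemma snake_labels_eq:
  assumes "d \<ge> 1"
  shows "snake_labels nr d a aa i = (\<Union>j\<in>{..d}. level_labels nr d a aa i j)"
proof -
  have "{..d} = insert 0 (insert d {1..<d})" using assms by auto
  then have "(\<Union>j\<in>{..d}. level_labels nr d a aa i j) =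
    level_labels nr d a aa i 0 \<union> (\<Union>j\<in>{1..<d}. level_labels nr d a aa i j) \<union> level_labels nr d a aa i d"
    by (simp add: Un_ac)
  moreover have "(\<Union>j\<in>{1..<d}. level_labels nr d a aa i j) =
    (\<Union>j\<in>{1..<d}. if nr j
          then {(north_e (tpos nr j), aa j), (east_e (tpos nr j), i (j + 1)),
                (west_e (tpos nr (j + 1)), i j)}
          else {(east_e (tpos nr j), aa j), (north_e (tpos nr j), i (j + 1)),
                (south_e (tpos nr (j + 1)), i j)})"
    by (rule SUP_cong) (simp_all add: level_labels_def)
  moreover have "level_labels nr d a aa i 0 = {(south_e (tpos nr 1), a), (west_e (tpos nr 1), i d)}"
    by (simp add: level_labels_def)
  moreover have "level_labels nr d a aa i d =
    (if odd d then {(north_e (tpos nr d), i 1), (east_e (tpos nr d), a)}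
        else {(east_e (tpos nr d), i 1), (north_e (tpos nr d), a)})"
    using assms by (simp add: level_labels_def)
  ultimately show ?thesis by (simp only: snake_labels_def)
qed

text \<open>The bound \<open>j \<le> d\<close> matters: past \<open>d\<close>,
  \<open>level_labels\<close> repeats the labels of the last tile.\<close>

lemma level_labels_level:
  assumes "(e, l) \<in> level_labels nr d a aa i j" "j \<le> d"
  shows "edge_level e = int j"
proof (cases "j = 0")
  case True
  then show ?thesis using assms by (auto simp: level_labels_def edge_level_simps)
next
  case False
  then have "j \<ge> 1" by simp
  note lev = tpos_level[OF this, of nr] and suc = tpos_Suc[OF this, of nr]
  show ?thesis
    using assms False lev suc
    by (auto simp: level_labels_def edge_level_simps simp del: tpos.simps split: if_splits)
qed

lemma level_labels_functional:
  assumes "(e, l) \<in> level_labels nr d a aa i j" "(e, l') \<in> level_labels nr d a aa i j"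
  shows "l = l'"
proof (cases "j = 0")
  case True
  then show ?thesis using assms by (auto simp: level_labels_def)
next
  case False
  then have "j \<ge> 1" by simp
  note suc = tpos_Suc[OF this, of nr]
  show ?thesis
    using assms False suc
    by (auto simp: level_labels_def simp del: tpos.simps split: if_splits)
qed

lemma edge_label_eq:
  assumes "d \<ge> 1" "j \<le> d" "(e, l) \<in> level_labels nr d a aa i j"
  shows "edge_label (snake_labels nr d a aa i) e = l"
  unfolding edge_label_def
proof (rule the_equality)
  show "(e, l) \<in> snake_labels nr d a aa i" using assms by (auto simp: snake_labels_eq)
next
  fix l' assume "(e, l') \<in> snake_labels nr d a aa i"
  then obtain j' where j': "j' \<le> d" "(e, l') \<in> level_labels nr d a aa i j'"
    using assms by (auto simp: snake_labels_eq)
  then have "j' = j"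
    using level_labels_level[OF j'(2,1)] level_labels_level[OF assms(3,2)] by simp
  then show "l' = l" using level_labels_functional j' assms(3) by metis
qed

lemma edge_label_first:
  assumes "d \<ge> 1"
  shows "edge_label (snake_labels nr d a aa i) (south_e (0, 0)) = a"
    "edge_label (snake_labels nr d a aa i) (west_e (0, 0)) = i d"
  by (rule edge_label_eq[where j = 0]; use assms in \<open>simp add: level_labels_def\<close>)+

lemma edge_label_last:
  assumes "d \<ge> 1"
  shows "edge_label (snake_labels nr d a aa i) (w_edge nr d) = i 1"
    "edge_label (snake_labels nr d a aa i) (z_edge nr d) = a"
  by (rule edge_label_eq[where j = d]; use assms in \<open>simp add: level_labels_def w_edge_def z_edge_def\<close>)+

lemma edge_label_inner:
  assumes "j \<ge> 1" "j < d"
  shows "edge_label (snake_labels nr d a aa i) (w_edge nr j) = (if shares_w nr j then aa j else i (j + 1))"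
    "edge_label (snake_labels nr d a aa i) (z_edge nr j) = (if shares_w nr j then i (j + 1) else aa j)"
    "edge_label (snake_labels nr d a aa i) (inner_side nr j) = i j"
  by (rule edge_label_eq[where j = j];
      use assms in \<open>simp add: level_labels_def w_edge_def z_edge_def shares_w_def inner_side_def
        del: tpos.simps\<close>)+

section \<open>The matrix product\<close>

lemma mat2_mult_nth:
  fixes M :: "'a::comm_ring_1^2^2"
  shows "(mat2 p q r s ** M) $ 1 $ l = p * M $ 1 $ l + q * M $ 2 $ l"
    "(mat2 p q r s ** M) $ 2 $ l = r * M $ 1 $ l + s * M $ 2 $ l"
  by (simp_all add: matrix_matrix_mult_def mat2_def sum_2)

text \<open>Dividing the \<open>w\<close>-coordinate by \<open>k\<close> and the
  \<open>z\<close>-coordinate by \<open>k + 1\<close> tile variables turns the recursion into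
  multiplication by \<open>m_j\<close>. At \<open>k = 0\<close> this leaves \<open>u\<close> and
  divides \<open>v\<close> by \<open>x (i 1)\<close>. The labels are those of the full snake, the
  sums those of its first \<open>k + 1\<close> tiles.\<close>

lemma state_sum_matrix:
  fixes x y :: "'l \<Rightarrow> 'a::field" and nr aa i d a
  defines "\<omega> \<equiv> \<lambda>e. x (edge_label (snake_labels nr d a aa i) e)" and "\<eta> \<equiv> \<lambda>j. y (i j)"
  assumes x: "\<And>l. x l \<noteq> 0" and k: "k < d"
    and u: "state_sum nr \<omega> \<eta> s 1 (w_edge nr 1) = u"
    and v: "state_sum nr \<omega> \<eta> s 1 (z_edge nr 1) = v"
  shows "state_sum nr \<omega> \<eta> s (Suc k) (w_edge nr (Suc k)) = (\<Prod>j=1..k. x (i j)) *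
      (snake_Mprod nr aa i x y k $ 1 $ 1 * u + snake_Mprod nr aa i x y k $ 1 $ 2 * (v / x (i 1))) \<and>
    state_sum nr \<omega> \<eta> s (Suc k) (z_edge nr (Suc k)) = (\<Prod>j=1..Suc k. x (i j)) *
      (snake_Mprod nr aa i x y k $ 2 $ 1 * u + snake_Mprod nr aa i x y k $ 2 $ 2 * (v / x (i 1)))"
  using k
proof (induction k)
  case 0
  then show ?case using u v x by (simp add: mat_def)
next
  case (Suc k)
  let ?j = "Suc k"
  have j: "?j \<ge> 1" "?j < d" using Suc.prems by simp_all
  have IH: "state_sum nr \<omega> \<eta> s ?j (w_edge nr ?j) = (\<Prod>j=1..k. x (i j)) *
      (snake_Mprod nr aa i x y k $ 1 $ 1 * u + snake_Mprod nr aa i x y k $ 1 $ 2 * (v / x (i 1)))"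
    "state_sum nr \<omega> \<eta> s ?j (z_edge nr ?j) = (\<Prod>j=1..k. x (i j)) * x (i ?j) *
      (snake_Mprod nr aa i x y k $ 2 $ 1 * u + snake_Mprod nr aa i x y k $ 2 $ 2 * (v / x (i 1)))"
    using Suc.IH j by simp_all
  have p: "(\<Prod>j=1..Suc k. x (i j)) = (\<Prod>j=1..k. x (i j)) * x (i ?j)"
    "(\<Prod>j=1..Suc (Suc k). x (i j)) = (\<Prod>j=1..k. x (i j)) * x (i ?j) * x (i (Suc ?j))"
    by simp_all
  note lab = edge_label_inner[OF j, of nr a aa i]
  note st = state_sum_Suc[OF j(1), where nr = nr and \<omega> = \<omega> and \<eta> = \<eta> and s = s]
  have x0: "x (i 1) \<noteq> 0" "x (i ?j) \<noteq> 0" "x (i (Suc ?j)) \<noteq> 0" using x by simp_all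
  show ?case
  proof (cases "shares_w nr ?j")
    case True
    have m: "snake_mj nr aa i x y ?j =
        mat2 1 0 (x (aa ?j) / (x (i ?j) * x (i (Suc ?j)))) (y (i ?j))"
      using True by (simp add: snake_mj_def shares_w_def)
    have W: "state_sum nr \<omega> \<eta> s (Suc ?j) (w_edge nr (Suc ?j)) =
        x (i ?j) * state_sum nr \<omega> \<eta> s ?j (w_edge nr ?j)"
      using st(1)[OF True] lab(3) by (simp add: \<omega>_def)
    have Z: "state_sum nr \<omega> \<eta> s (Suc ?j) (z_edge nr (Suc ?j)) =
        x (aa ?j) * state_sum nr \<omega> \<eta> s ?j (w_edge nr ?j) +
        x (i (Suc ?j)) * y (i ?j) * state_sum nr \<omega> \<eta> s ?j (z_edge nr ?j)"
      using st(3) True lab(1,2) by (simp add: \<omega>_def \<eta>_def)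
    show ?thesis
      unfolding W Z IH p snake_Mprod.simps(2) m mat2_mult_nth using x0 by (simp add: field_simps)
  next
    case False
    have m: "snake_mj nr aa i x y ?j =
        mat2 (x (i (Suc ?j)) / x (i ?j)) (x (aa ?j) * y (i ?j)) 0 (x (i ?j) * y (i ?j) / x (i (Suc ?j)))"
      using False unfolding snake_mj_def shares_w_def[symmetric] by simp
    have Z: "state_sum nr \<omega> \<eta> s (Suc ?j) (z_edge nr (Suc ?j)) =
        x (i ?j) * y (i ?j) * state_sum nr \<omega> \<eta> s ?j (z_edge nr ?j)"
      using st(2)[OF False] lab(3) by (simp add: \<omega>_def \<eta>_def)
    have W: "state_sum nr \<omega> \<eta> s (Suc ?j) (w_edge nr (Suc ?j)) =
        x (i (Suc ?j)) * state_sum nr \<omega> \<eta> s ?j (w_edge nr ?j) +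
        x (aa ?j) * y (i ?j) * state_sum nr \<omega> \<eta> s ?j (z_edge nr ?j)"
      using st(3) False lab(1,2) by (simp add: \<omega>_def \<eta>_def)
    show ?thesis
      unfolding W Z IH p snake_Mprod.simps(2) m mat2_mult_nth using x0 by (simp add: field_simps)
  qed
qed

section \<open>From weights and heights to the trace\<close>

lemma match_weight_height_eq:
  assumes "d \<ge> 1" "P \<in> matchings (snake_edges nr d)"
  shows "match_weight nr d a aa i x P * height nr d i y P =
    full_weight nr (\<lambda>e. x (edge_label (snake_labels nr d a aa i) e)) (\<lambda>j. y (i j)) d P"
proof -
  have "{j \<in> {1..d}. tile_enclosed (sym_diff P (minimal nr d)) (tpos nr j)} = enclosed_tiles nr d P"
    using enclosed_tiles_subset[OF assms] by (auto simp: enclosed_tiles_def)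
  then show ?thesis
    by (simp add: match_weight_def height_def full_weight_def min_matching_eq[OF assms(1)] Let_def)
qed

theorem mainTheorem5:
  fixes d :: nat and nr :: "nat \<Rightarrow> bool"
    and a :: 'l and aa :: "nat \<Rightarrow> 'l" and i :: "nat \<Rightarrow> 'l"
    and x :: "'l \<Rightarrow> 'a::field" and y :: "'l \<Rightarrow> 'a"
  assumes "d \<ge> 1"
    and "\<And>l. x l \<noteq> 0"
  shows "(\<Sum>P\<in>{P. perfect_matching nr d P \<and>
                   (south_e (tpos nr 1) \<in> P \<or> z_edge nr d \<in> P)}.
            match_weight nr d a aa i x P * height nr d i y P / x a)
         = (\<Prod>j=1..d. x (i j)) *
           trace (mat2 (x (i 1) / x (i d)) (x a * y (i d))
                       0 (y (i d) * x (i d) / x (i 1)) ** snake_M nr d aa i x y)"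
proof -
  define \<omega> where "\<omega> = (\<lambda>e. x (edge_label (snake_labels nr d a aa i) e))"
  define \<eta> where "\<eta> = (\<lambda>j. y (i j))"
  let ?T = "start_matchings nr True d"
  let ?F = "{P \<in> start_matchings nr False d. z_edge nr d \<in> P}"
  let ?f = "full_weight nr \<omega> \<eta> d"
  let ?w = "\<lambda>s. state_sum nr \<omega> \<eta> s d (w_edge nr d)" and ?z = "\<lambda>s. state_sum nr \<omega> \<eta> s d (z_edge nr d)"
  obtain k where k: "d = Suc k" using assms(1) by (cases d) auto
  let ?M = "snake_Mprod nr aa i x y k" and ?p = "\<Prod>j=1..k. x (i j)"
  have x0: "x a \<noteq> 0" "x (i 1) \<noteq> 0" "x (i d) \<noteq> 0" using assms(2) by simp_all
  have \<omega>: "\<omega> (south_e (0, 0)) = x a" "\<omega> (west_e (0, 0)) = x (i d)"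
    "\<omega> (w_edge nr d) = x (i 1)" "\<omega> (z_edge nr d) = x a"
    using edge_label_first[OF assms(1), of nr a aa i] edge_label_last[OF assms(1), of nr a aa i]
    by (simp_all add: \<omega>_def)
  note vec = state_sum_matrix[of x k d nr a aa i y, OF assms(2), folded \<omega>_def \<eta>_def]
  \<comment> \<open>Starting with the south edge means \<open>u = x a\<close> and
    \<open>v = 0\<close>, which singles out the first column.\<close>
  have wT: "?w True = ?p * (?M $ 1 $ 1 * x a)" and zT: "?z True = ?p * x (i d) * (?M $ 2 $ 1 * x a)"
    using vec[OF _ state_sum_1(1,2)] k by (simp_all add: \<omega>)
  \<comment> \<open>Starting with the west edge means \<open>u = 0\<close> and
    \<open>v = x (i d)\<close>, which singles out the second column.\<close>
  have zF: "?z False = ?p * x (i d) * (?M $ 2 $ 2 * (x (i d) / x (i 1)))"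
    using vec[OF _ state_sum_1(3,4)] k by (simp add: \<omega>)
  have S: "{P. perfect_matching nr d P \<and> (south_e (tpos nr 1) \<in> P \<or> z_edge nr d \<in> P)} = ?T \<union> ?F"
    by (auto simp: perfect_matching_iff start_matchings_def)
  have "(\<Sum>P\<in>?T \<union> ?F. match_weight nr d a aa i x P * height nr d i y P / x a) =
    (\<Sum>P\<in>?T \<union> ?F. ?f P) / x a"
    unfolding sum_divide_distrib
    by (rule sum.cong) (auto simp: start_matchings_def match_weight_height_eq[OF assms(1)] \<omega>_def \<eta>_def)
  also have "(\<Sum>P\<in>?T \<union> ?F. ?f P) = sum ?f ?T + sum ?f ?F"
    by (rule sum.union_disjoint) (auto simp: finite_start_matchings, auto simp: start_matchings_def)
  \<comment> \<open>The omitted matchings avoid both copies of the cut edge. They belong to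
    \<open>?w False\<close>, that is to \<open>?M $ 1 $ 2\<close>, which the zero entry of the
    closing matrix keeps out of the trace.\<close>
  also have "\<dots> = x (i 1) * ?w True + x a * y (i d) * ?z True + x a * y (i d) * ?z False"
    by (simp add: full_weight_sum[OF assms(1)] full_weight_sum_z[OF assms(1)] \<omega> \<eta>_def)
  \<comment> \<open>In each term one factor \<open>x a\<close> cancels: the start value in the sums
    over \<open>?T\<close>, the weight of the \<open>z\<close>-edge in the sum over
    \<open>?F\<close>.\<close>
  also have "\<dots> / x a = ?p * x (i d) *
    (x (i 1) / x (i d) * ?M $ 1 $ 1 + x a * y (i d) * ?M $ 2 $ 1 + y (i d) * x (i d) / x (i 1) * ?M $ 2 $ 2)"
    unfolding wT zT zF using x0 by (simp add: field_simps)
  also have "?p * x (i d) = (\<Prod>j=1..d. x (i j))" by (simp add: k)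
  finally show ?thesis
    unfolding S by (simp add: trace_def sum_2 mat2_mult_nth snake_M_def k)
qed

end
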